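(* Let $n\ge 1$, let $\mathbb{I}=\{S_i\}_{i=1}^N$ be an affine IFS on $\mathbb{R}^n$ with affinity dimension $s$, let $C\subset\mathbb{R}^n$ be a non-empty compact set, let $F_\emptyset$ be the homogeneous attractor of $\mathbb{I}$ and let $F_C$ be the inhomogeneous self-affine set of $\mathbb{I}$ with condensation set $C$. Then: (1) if $\overline{\dim}_{\mathrm{B}}F_\emptyset=s$, then $\overline{\dim}_{\mathrm{B}}F_C=\max\{\overline{\dim}_{\mathrm{B}}F_\emptyset,\ \overline{\dim}_{\mathrm{B}}C\}$; (2) if $\overline{\dim}_{\mathrm{B}}C\ge s$, then $\overline{\dim}_{\mathrm{B}}F_C=\overline{\dim}_{\mathrm{B}}C$.
   Context: An affine IFS on $\mathbb{R}^n$ is a finite collection $\{S_i\}_{i=1}^N$ of affine maps $S_i(x)=A_ix+b_i$ with $A_i\in \mathrm{GL}(\mathbb{R},n)$, $b_i\in\mathbb{R}^n$, each contracting: there is $c\in(0,1)$ with $|S_i(x)-S_i(y)|\le c|x-y|$ for all $x,y$ (Euclidean norm). The homogeneous attractor $F_\emptyset$ is the unique non-empty compact set with $F_\emptyset=\bigcup_{i=1}^N S_i(F_\emptyset)$. For compact $C\subset\mathbb{R}^n$, the inhomogeneous self-affine set $F_C$ with condensation set $C$ is the unique non-empty compact set with $F_C=\bigcup_{i=1}^N S_i(F_C)\cup C$. Words: $\mathcal{I}=\{1,\dots,N\}$, and for $\mathbf{i}=(i_1,\dots,i_k)\in\mathcal{I}^k$, $S_{\mathbf{i}}=S_{i_1}\circ\cdots\circ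 S_{i_k}$. Affinity dimension: for $A\in\mathrm{GL}(\mathbb{R},n)$ let $\alpha_1(A)\ge\dots\ge\alpha_n(A)>0$ be its singular values. For $0< t\le n$ put $\phi^t(A)=\alpha_1(A)\cdots\alpha_{m-1}(A)\,\alpha_m(A)^{t-m+1}$, where $m$ is the integer with $m-1<t\le m$; put $\phi^0(A)=1$ and $\phi^t(A)=|\det A|^{t/n}$ for $t>n$. For an affine map $S$ with linear part $A$, $\phi^t(S)=\phi^t(A)$. For $k\in\mathbb{N}$ let $s_k$ be the solution of $\sum_{\mathbf{i}\in\mathcal{I}^k}\phi^{s_k}(S_{\mathbf{i}})=1$. The limit $s=\lim_{k\to\infty}s_k$ exists and is called the affinity dimension of the IFS. Box dimension: for non-empty bounded $F\subset\mathbb{R}^n$, $N_\delta(F)$ is the minimum number of hypercubes of sidelength $\delta$ needed to cover $F$, and $\overline{\dim}_{\mathrm{B}}F=\limsup_{\delta\to0}\frac{\log N_\delta(F)}{-\log\delta}$. *)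

theory Defs
  imports "HOL-Analysis.Analysis" "HOL-Library.Multiset"
begin

text \<open>
  An iterated function system is given by a number \<open>N\<close> and maps \<open>S 1, \<dots>, S N\<close>; values of \<open>S\<close> outside
  \<open>{1..N}\<close> play no role. The ambient space is \<open>real ^ 'n\<close>, whose norm is the Euclidean one.
\<close>

definition affine_ifs :: "nat \<Rightarrow> (nat \<Rightarrow> real ^ 'n \<Rightarrow> real ^ 'n) \<Rightarrow> bool" where
  "affine_ifs N S \<longleftrightarrow> N \<ge> 1 \<and>
     (\<forall>i\<in>{1..N}. (\<exists>A b. invertible A \<and> S i = (\<lambda>x. A *v x + b)) \<and>
                 (\<exists>c. 0 < c \<and> c < 1 \<and> (\<forall>x y. norm (S i x - S i y) \<le> c * norm (x - y))))"

text \<open>The homogeneous attractor is the case \<open>C = {}\<close>. For an affine IFS and compact \<open>C\<close> there is exactly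
  one set \<open>F\<close> with this property.\<close>

definition is_inhomogeneous_attractor ::
  "nat \<Rightarrow> (nat \<Rightarrow> real ^ 'n \<Rightarrow> real ^ 'n) \<Rightarrow> (real ^ 'n) set \<Rightarrow> (real ^ 'n) set \<Rightarrow> bool" where
  "is_inhomogeneous_attractor N S C F \<longleftrightarrow>
     F \<noteq> {} \<and> compact F \<and> F = (\<Union>i\<in>{1..N}. S i ` F) \<union> C"

definition words :: "nat \<Rightarrow> nat \<Rightarrow> nat list set" where
  "words N k = {w. set w \<subseteq> {1..N} \<and> length w = k}"

definition word_map :: "(nat \<Rightarrow> 'a \<Rightarrow> 'a) \<Rightarrow> nat list \<Rightarrow> 'a \<Rightarrow> 'a" where
  "word_map S w = foldr (\<lambda>i f. S i \<circ> f) w id"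

text \<open>The singular values are the square roots of the eigenvalues of \<open>A\<^sup>T A\<close>, counted with multiplicity.
  Since \<open>A\<^sup>T A\<close> is symmetric, the multiplicity of an eigenvalue is the dimension of its eigenspace.\<close>

definition singular_values :: "real ^ 'n ^ 'n \<Rightarrow> real multiset" where
  "singular_values A =
     (let M = transpose A ** A
      in \<Sum>\<mu> | \<exists>v. v \<noteq> 0 \<and> M *v v = \<mu> *\<^sub>R v. replicate_mset (dim {v. M *v v = \<mu> *\<^sub>R v}) (sqrt \<mu>))"

text \<open>\<open>singular_value A j\<close> is the \<open>j\<close>-th largest singular value, for \<open>1 \<le> j \<le> n\<close>.\<close>

definition singular_value :: "real ^ 'n ^ 'n \<Rightarrow> nat \<Rightarrow> real" where
  "singular_value A j = rev (sorted_list_of_multiset (singular_values A)) ! (j - 1)"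

text \<open>Only \<open>t \<ge> 0\<close> is meaningful. In the middle case \<open>m = \<lceil>t\<rceil>\<close> is the integer with \<open>m - 1 < t \<le> m\<close>.\<close>

definition singular_value_function :: "real \<Rightarrow> real ^ 'n ^ 'n \<Rightarrow> real" where
  "singular_value_function t A =
     (if t = 0 then 1
      else if t \<le> real CARD('n) then
        (let m = nat \<lceil>t\<rceil>
         in (\<Prod>j = 1..m - 1. singular_value A j) * singular_value A m powr (t - real m + 1))
      else \<bar>det A\<bar> powr (t / real CARD('n)))"

definition linear_part :: "(real ^ 'n \<Rightarrow> real ^ 'n) \<Rightarrow> real ^ 'n ^ 'n" where
  "linear_part f = matrix (\<lambda>x. f x - f 0)"

text \<open>For \<open>k \<ge> 1\<close> and an affine IFS the solution is unique. The value at \<open>k = 0\<close> is arbitrary and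
  does not affect the limit below.\<close>

definition affinity_exponent :: "nat \<Rightarrow> (nat \<Rightarrow> real ^ 'n \<Rightarrow> real ^ 'n) \<Rightarrow> nat \<Rightarrow> real" where
  "affinity_exponent N S k =
     (THE t. 0 \<le> t \<and>
        (\<Sum>w\<in>words N k. singular_value_function t (linear_part (word_map S w))) = 1)"

definition affinity_dimension :: "nat \<Rightarrow> (nat \<Rightarrow> real ^ 'n \<Rightarrow> real ^ 'n) \<Rightarrow> real" where
  "affinity_dimension N S = lim (affinity_exponent N S)"

text \<open>Hypercubes are closed and may have any orientation.\<close>

definition hypercube :: "real \<Rightarrow> (real ^ 'n) set \<Rightarrow> bool" where
  "hypercube \<delta> Q \<longleftrightarrow>
     (\<exists>(R :: real ^ 'n \<Rightarrow> real ^ 'n) a. orthogonal_transformation R \<and> Q = (\<lambda>x. a + R x) ` cbox 0 (\<chi> i. \<delta>))"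

definition covering_number :: "real \<Rightarrow> (real ^ 'n) set \<Rightarrow> nat" where
  "covering_number \<delta> F =
     (LEAST k. \<exists>\<Q>. finite \<Q> \<and> card \<Q> = k \<and> (\<forall>Q\<in>\<Q>. hypercube \<delta> Q) \<and> F \<subseteq> \<Union>\<Q>)"

definition upper_box_dim :: "(real ^ 'n) set \<Rightarrow> ereal" where
  "upper_box_dim F =
     Limsup (at_right 0) (\<lambda>\<delta>. ereal (ln (real (covering_number \<delta> F)) / (- ln \<delta>)))"

end

theory Submission
  imports Defs
begin

text \<open>The substance is the upper bound
  \<open>upper_box_dim F\<^sub>C \<le> max s (upper_box_dim C)\<close>; the lower bounds are monotonicity, since \<open>F\<^sub>C\<close> contains
  \<open>C\<close> and, being closed and mapped into itself by every \<open>S i\<close>, also the homogeneous attractor.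

  For the upper bound let \<open>t \<le> n\<close> exceed both \<open>s\<close> and the dimension of \<open>C\<close>. If \<open>A\<close> maps the unit ball
  into \<open>m\<close> balls of radius \<open>\<delta>\<close>, it maps a ball of radius \<open>\<rho>\<close> into \<open>m\<close> balls of radius \<open>\<delta> \<rho>\<close>. The
  smallest value of \<open>m \<delta>\<^sup>t\<close> over all such coverings is the singular value function of \<open>A\<close> at \<open>t\<close>, up
  to a constant that depends on \<open>n\<close> only, and an optimal \<open>\<delta>\<close> is the singular value of index
  \<open>\<lceil>t\<rceil>\<close>. As \<open>t > s\<close>, some word length \<open>k\<close> makes the sum of \<open>m\<^sub>w \<delta>\<^sub>w\<^sup>t\<close> over the words of length
  \<open>k\<close> smaller than 1. Writing \<open>F\<^sub>C\<close> as the union of its images under words of length \<open>k\<close> and of the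
  finitely many images of \<open>C\<close> under shorter words, the number \<open>N(r)\<close> of balls of radius \<open>r\<close> that cover
  \<open>F\<^sub>C\<close> satisfies the renewal inequality \<open>N(r) \<le> (\<Sum>w. m\<^sub>w N(r / \<delta>\<^sub>w)) + K * r powr - t\<close>, and
  induction on the scale gives \<open>N(r) \<le> L * r powr - t\<close> (\<open>covering_growth_renewal\<close>). For \<open>t > n\<close> the
  bound holds because \<open>F\<^sub>C\<close> is bounded.

  That such a \<open>k\<close> exists rests on the sequence of affinity exponents being well defined and convergent.
  The sums of the singular value function over the words of length \<open>k\<close> are continuous and strictly
  decreasing in \<open>t\<close>, and they are submultiplicative in \<open>k\<close> up to a constant. The last point follows
  from the same description by coverings: coverings of the images of the unit ball under \<open>A\<close> and \<open>B\<close>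
  compose to a covering of its image under \<open>A B\<close>
  (\<open>singular_value_function_submultiplicative\<close>). The comparison of covering numbers with singular
  values is a volume estimate for the diagonal factor of a singular value decomposition.\<close>

section \<open>Singular value decomposition\<close>

lemma selfadjoint_eigenvector_exists:
  fixes f :: "'a::euclidean_space \<Rightarrow> 'a"
  assumes lin: "linear f" and sym: "\<And>x y. f x \<bullet> y = x \<bullet> f y"
    and V: "subspace V" "f ` V \<subseteq> V" "V \<noteq> {0}"
  obtains v \<mu> where "v \<in> V" "norm v = 1" "f v = \<mu> *\<^sub>R v"
proof -
  interpret linear f by fact
  obtain z where z: "z \<in> V" "z \<noteq> 0"
    using V subspace_0 by blast
  let ?K = "V \<inter> sphere 0 1"
  have "compact ?K"
    using V by (simp add: closed_Int_compact closed_subspace)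
  moreover have "(1 / norm z) *\<^sub>R z \<in> ?K"
    using z V by (auto simp: subspace_scale)
  moreover have "continuous_on ?K (\<lambda>x. x \<bullet> f x)"
    by (intro continuous_intros linear_continuous_on linear_conv_bounded_linear[THEN iffD1] lin)
  ultimately obtain v where v: "v \<in> ?K" and vmax: "\<And>y. y \<in> ?K \<Longrightarrow> y \<bullet> f y \<le> v \<bullet> f v"
    using continuous_attains_sup[of ?K "\<lambda>x. x \<bullet> f x"] by blast
  define \<mu> where "\<mu> = v \<bullet> f v"
  have le: "x \<bullet> f x \<le> \<mu> * (x \<bullet> x)" if x: "x \<in> V" for x
  proof (cases "x = 0")
    case False
    have "(1 / norm x) *\<^sub>R x \<in> ?K"
      using x V False by (auto simp: subspace_scale)
    from vmax[OF this] have "(x \<bullet> f x) / (norm x * norm x) \<le> \<mu>"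
      by (simp add: scaleR \<mu>_def)
    then show ?thesis
      using False by (simp add: dot_square_norm power2_eq_square pos_divide_le_eq)
  qed (simp add: zero)
  define d where "d = f v - \<mu> *\<^sub>R v"
  have dV: "d \<in> V"
    using V v by (auto simp: d_def intro!: subspace_diff subspace_scale)
  have vv: "v \<bullet> v = 1"
    using v by (simp add: dot_square_norm)
  \<comment> \<open>Maximality along the line through \<open>v\<close> in direction \<open>d\<close> forces the first-order term to vanish.\<close>
  have quad: "2 * t * (d \<bullet> d) + t\<^sup>2 * (d \<bullet> f d - \<mu> * (d \<bullet> d)) \<le> 0" for t
  proof -
    have "(v + t *\<^sub>R d) \<bullet> f (v + t *\<^sub>R d) \<le> \<mu> * ((v + t *\<^sub>R d) \<bullet> (v + t *\<^sub>R d))"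
      using v dV V by (intro le subspace_add subspace_scale) auto
    moreover have "v \<bullet> f d = d \<bullet> f v"
      using sym[of v d] by (simp add: inner_commute)
    moreover have "d \<bullet> f v = d \<bullet> d + \<mu> * (d \<bullet> v)"
      by (metis d_def diff_add_cancel inner_add_right inner_scaleR_right)
    ultimately show ?thesis
      by (simp add: add scaleR inner_add_left inner_add_right inner_commute[of v d] vv
          \<mu>_def[symmetric] power2_eq_square algebra_simps)
  qed
  have "d = 0"
  proof (rule ccontr)
    assume "d \<noteq> 0"
    define a b where "a = d \<bullet> d" and "b = d \<bullet> f d - \<mu> * (d \<bullet> d)"
    have a: "a > 0"
      using \<open>d \<noteq> 0\<close> by (simp add: a_def)
    define t where "t = a / (\<bar>b\<bar> + 1)"
    have t: "t > 0"
      using a by (simp add: t_def add_nonneg_pos)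
    have "t * \<bar>b\<bar> \<le> a"
      using a by (simp add: t_def divide_simps mult_left_mono) 
    then have "- (t * b) < 2 * a"
      using a t abs_ge_minus_self[of "t * b"] by (simp add: abs_mult)
    then have "0 < t * (2 * a + t * b)"
      using t by simp
    also have "\<dots> = 2 * t * a + t\<^sup>2 * b"
      by (simp add: power2_eq_square algebra_simps)
    finally show False
      using quad[of t] by (simp add: a_def b_def)
  qed
  then show thesis
    using v that[of v \<mu>] by (simp add: d_def)
qed

text \<open>The orthogonal complement of an eigenvector inside an invariant subspace is again invariant, so
  eigenvectors can be split off one at a time.\<close>

lemma selfadjoint_orthonormal_eigenbasis:
  fixes f :: "'a::euclidean_space \<Rightarrow> 'a"
  assumes lin: "linear f" and sym: "\<And>x y. f x \<bullet> y = x \<bullet> f y"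
    and "subspace V" "f ` V \<subseteq> V"
  shows "\<exists>B\<subseteq>V. finite B \<and> card B = dim V \<and> pairwise orthogonal B \<and>
           (\<forall>b\<in>B. norm b = 1 \<and> (\<exists>\<mu>. f b = \<mu> *\<^sub>R b))"
  using assms(3,4)
proof (induction "dim V" arbitrary: V)
  case 0
  then show ?case
    by (intro exI[of _ "{}"]) (auto simp: dim_eq_0)
next
  case (Suc n)
  then have "V \<noteq> {0}"
    by (metis dim_eq_0 nat.distinct(1) order_refl)
  then obtain v \<mu> where v: "v \<in> V" "norm v = 1" "f v = \<mu> *\<^sub>R v"
    using selfadjoint_eigenvector_exists[OF lin sym Suc.prems] by blast
  define W where "W = {w \<in> V. orthogonal v w}"
  have sW: "subspace W"
    using Suc.prems(1) by (auto simp: W_def subspace_def orthogonal_clauses)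
  have fW: "f ` W \<subseteq> W"
    using Suc.prems(2) by (auto simp: W_def orthogonal_def sym[symmetric] v(3))
  have "dim W + 1 = dim V"
  proof -
    have "dim {y \<in> V. \<forall>x \<in> span {v}. orthogonal x y} + dim (span {v}) = dim V"
      using Suc.prems(1) v(1)
      by (intro dim_subspace_orthogonal_to_vectors) (auto simp: span_minimal)
    moreover have "{y \<in> V. \<forall>x \<in> span {v}. orthogonal x y} = W"
      by (auto simp: W_def span_singleton orthogonal_clauses dest: spec[of _ 1])
    moreover have "dim (span {v}) = 1"
      using v(2) by (auto simp: dim_insert)
    ultimately show ?thesis by simp
  qed
  then have dimW: "n = dim W"
    using Suc.hyps(2) by simp
  obtain B where B: "B \<subseteq> W" "finite B" "card B = dim W" "pairwise orthogonal B"
      "\<And>b. b \<in> B \<Longrightarrow> norm b = 1 \<and> (\<exists>\<mu>. f b = \<mu> *\<^sub>R b)"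
    using Suc.hyps(1)[OF dimW sW fW]
    by blast
  have orth: "orthogonal v b" "orthogonal b v" if "b \<in> B" for b
    using B(1) that by (auto simp: W_def orthogonal_commute)
  have "v \<notin> B"
    using orth(1)[of v] v(2) by (auto simp: orthogonal_def)
  with B orth v show ?case
    using Suc.hyps(2) dimW
    by (intro exI[of _ "insert v B"]) (auto simp: pairwise_insert W_def)
qed

definition diagonal_matrix :: "('n \<Rightarrow> real) \<Rightarrow> real ^ 'n ^ 'n" where
  "diagonal_matrix a = (\<chi> i j. if i = j then a i else 0)"

lemma diagonal_matrix_mult_vector: "(diagonal_matrix a *v x) $ i = a i * x $ i"
  by (simp add: diagonal_matrix_def matrix_vector_mult_def if_distrib[where f = "\<lambda>z. z * _"] cong: if_cong)

lemma det_diagonal_matrix: "det (diagonal_matrix a) = (\<Prod>i\<in>UNIV. a i)"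
  by (subst det_diagonal) (auto simp: diagonal_matrix_def)

lemma transpose_diagonal_matrix [simp]: "transpose (diagonal_matrix a) = diagonal_matrix a"
  by (auto simp: diagonal_matrix_def transpose_def vec_eq_iff)

lemma norm_orthogonal_matrix_mult:
  fixes Q :: "real ^ 'n ^ 'n"
  assumes "orthogonal_matrix Q"
  shows "norm (Q *v x) = norm x"
proof -
  have "orthogonal_transformation ((*v) Q)"
    using assms by (simp add: orthogonal_transformation_matrix)
  then show ?thesis
    by (rule orthogonal_transformation_norm)
qed

lemma orthogonal_matrix_cancel:
  fixes Q :: "real ^ 'n ^ 'n"
  assumes "orthogonal_matrix Q"
  shows "transpose Q *v (Q *v x) = x" "Q *v (transpose Q *v x) = x"
  using assms by (simp_all del: transpose_matrix_vector
    add: matrix_vector_mul_assoc orthogonal_matrix_def)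

lemma orthogonal_matrix_image_cball:
  fixes Q :: "real ^ 'n ^ 'n"
  assumes "orthogonal_matrix Q"
  shows "(*v) Q ` cball 0 r = cball 0 r"
proof -
  have "orthogonal_transformation ((*v) Q)"
    using assms by (simp add: orthogonal_transformation_matrix)
  then show ?thesis
    using image_orthogonal_transformation_cball[of "(*v) Q" 0 r] by simp
qed

text \<open>An orthonormal eigenbasis of the Gram matrix of \<open>A\<close> is mapped by \<open>A\<close> to an orthogonal basis; the
  lengths of the image vectors are the diagonal entries.\<close>

lemma singular_value_decomposition:
  fixes A :: "real ^ 'n ^ 'n"
  assumes "invertible A"
  obtains Q P a where "orthogonal_matrix Q" "orthogonal_matrix P" "\<And>i. a i > 0"
    "A = Q ** diagonal_matrix a ** transpose P"
proof -
  define M where "M = transpose A ** A"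
  have M_inner: "(M *v x) \<bullet> y = (A *v x) \<bullet> (A *v y)" for x y
    unfolding M_def matrix_vector_mul_assoc[symmetric] transpose_matrix_vector
    by (rule dot_lmul_matrix)
  obtain B :: "(real ^ 'n) set" where B: "finite B" "card B = CARD('n)" "pairwise orthogonal B"
      "\<And>b. b \<in> B \<Longrightarrow> norm b = 1 \<and> (\<exists>\<mu>. M *v b = \<mu> *\<^sub>R b)"
    using selfadjoint_orthonormal_eigenbasis[of "(*v) M" UNIV] M_inner
    by (auto simp: inner_commute)
  obtain v where v: "bij_betw v (UNIV :: 'n set) B"
    using B(1,2) finite_same_card_bij[of "UNIV :: 'n set" B] by auto
  have orth_v: "v i \<bullet> v j = (if i = j then 1 else 0)" for i j
  proof -
    have "v i \<in> B" "v j \<in> B" "v i = v j \<longleftrightarrow> i = j"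
      using v by (auto simp: bij_betw_def inj_on_def)
    then show ?thesis
      using B(3,4) by (auto simp: pairwise_def orthogonal_def dot_square_norm)
  qed
  obtain \<mu> where \<mu>: "M *v v i = \<mu> i *\<^sub>R v i" for i
  proof -
    have "\<exists>\<mu>. M *v v i = \<mu> *\<^sub>R v i" for i
      using B(4) v by (auto simp: bij_betw_def)
    then show thesis
      using that by metis
  qed
  have inner_Av: "(A *v v i) \<bullet> (A *v v j) = (if i = j then \<mu> i else 0)" for i j
    using M_inner[of "v i" "v j"] by (cases "i = j") (auto simp: \<mu> orth_v)
  have \<mu>_pos: "\<mu> i > 0" for i
  proof -
    have "v i \<noteq> 0"
      using orth_v[of i i] by auto
    then have "A *v v i \<noteq> 0"
      using assms by (metis invertible_def matrix_vector_mul_assoc matrix_vector_mul_lid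
          matrix_vector_mult_0_right)
    then show ?thesis
      using inner_Av[of i i] by (metis inner_gt_zero_iff)
  qed
  define a where "a i = sqrt (\<mu> i)" for i
  have a: "a i > 0" "a i * a i = \<mu> i" for i
    using \<mu>_pos[of i] by (auto simp: a_def)
  define P :: "real ^ 'n ^ 'n" where "P = (\<chi> r c. v c $ r)"
  define Q :: "real ^ 'n ^ 'n" where "Q = (\<chi> r c. (1 / a c) * (A *v v c) $ r)"
  have colP: "column c P = v c" for c
    by (simp add: column_def P_def)
  have colQ: "column c Q = (1 / a c) *\<^sub>R (A *v v c)" for c
    by (simp add: column_def Q_def vec_eq_iff)
  have P: "orthogonal_matrix P"
    by (auto simp: orthogonal_matrix_orthonormal_columns colP orthogonal_def orth_v norm_eq_1)
  have Q: "orthogonal_matrix Q"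
    unfolding orthogonal_matrix_orthonormal_columns colQ
    using a less_imp_neq[OF a(1)] by (auto simp: orthogonal_def inner_Av norm_eq_sqrt_inner a_def)
  have "A ** P = Q ** diagonal_matrix a"
  proof -
    have "(A ** P) $ r $ c = (Q ** diagonal_matrix a) $ r $ c" for r c
    proof -
      have "(A ** P) $ r $ c = (A *v v c) $ r"
        by (simp add: matrix_matrix_mult_def P_def matrix_vector_mult_def)
      also have "\<dots> = Q $ r $ c * a c"
        using a(1)[of c] by (simp add: Q_def)
      also have "\<dots> = (Q ** diagonal_matrix a) $ r $ c"
        by (simp add: matrix_matrix_mult_def diagonal_matrix_def if_distrib[where f = "\<lambda>z. _ * z"]
            cong: if_cong)
      finally show ?thesis .
    qed
    then show ?thesis by (simp add: vec_eq_iff)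
  qed
  then have "A = Q ** diagonal_matrix a ** transpose P"
    using P by (metis matrix_mul_assoc matrix_mul_rid orthogonal_matrix_def)
  then show thesis
    using that[OF Q P, of a] a(1) by blast
qed

text \<open>Conjugation by \<open>P\<close> turns the Gram matrix into the diagonal matrix of the squares of \<open>a\<close>, whose
  eigenspaces are coordinate subspaces. The dimension of the eigenspace of \<open>\<mu>\<close> is therefore the number
  of indices with \<open>(a i)\<^sup>2 = \<mu>\<close>, which is the multiplicity used in the multiset of singular values.\<close>

lemma singular_values_decomposition:
  fixes Q P :: "real ^ 'n ^ 'n"
  assumes Q: "orthogonal_matrix Q" and P: "orthogonal_matrix P" and a: "\<And>i. a i > 0"
  shows "singular_values (Q ** diagonal_matrix a ** transpose P) = image_mset a (mset_set UNIV)"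
proof -
  define A where "A = Q ** diagonal_matrix a ** transpose P"
  define M where "M = transpose A ** A"
  have M_mult: "M *v (P *v y) = P *v (diagonal_matrix a *v (diagonal_matrix a *v y))" for y
    using orthogonal_matrix_cancel[OF Q] orthogonal_matrix_cancel[OF P]
    by (simp del: transpose_matrix_vector
        add: M_def A_def matrix_transpose_mul transpose_transpose matrix_vector_mul_assoc[symmetric])
  have P_inj: "inj ((*v) P)"
    by (metis P injI orthogonal_matrix_cancel(1))
  have eig: "M *v (P *v y) = \<mu> *\<^sub>R (P *v y) \<longleftrightarrow> (\<forall>i. y $ i \<noteq> 0 \<longrightarrow> (a i)\<^sup>2 = \<mu>)" for y \<mu>
  proof -
    have "M *v (P *v y) = \<mu> *\<^sub>R (P *v y) \<longleftrightarrow> diagonal_matrix a *v (diagonal_matrix a *v y) = \<mu> *\<^sub>R y"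
      unfolding M_mult matrix_vector_mult_scaleR[symmetric] using P_inj by (simp add: inj_eq)
    also have "\<dots> \<longleftrightarrow> (\<forall>i. y $ i \<noteq> 0 \<longrightarrow> (a i)\<^sup>2 = \<mu>)"
      by (auto simp: vec_eq_iff diagonal_matrix_mult_vector power2_eq_square)
    finally show ?thesis .
  qed
  have eigenspace: "{v. M *v v = \<mu> *\<^sub>R v} = (*v) P ` {y. \<forall>i. (a i)\<^sup>2 \<noteq> \<mu> \<longrightarrow> y $ i = 0}" for \<mu>
  proof (intro set_eqI iffI)
    fix v assume "v \<in> {v. M *v v = \<mu> *\<^sub>R v}"
    then have "M *v (P *v (transpose P *v v)) = \<mu> *\<^sub>R (P *v (transpose P *v v))"
      using orthogonal_matrix_cancel[OF P] by (simp del: transpose_matrix_vector)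
    then have "\<forall>i. (a i)\<^sup>2 \<noteq> \<mu> \<longrightarrow> (transpose P *v v) $ i = 0"
      unfolding eig by blast
    then show "v \<in> (*v) P ` {y. \<forall>i. (a i)\<^sup>2 \<noteq> \<mu> \<longrightarrow> y $ i = 0}"
      using orthogonal_matrix_cancel(2)[OF P, of v]
      by (intro image_eqI[of _ _ "transpose P *v v"]) simp_all
  next
    fix v assume "v \<in> (*v) P ` {y. \<forall>i. (a i)\<^sup>2 \<noteq> \<mu> \<longrightarrow> y $ i = 0}"
    then show "v \<in> {v. M *v v = \<mu> *\<^sub>R v}"
      using eig by auto
  qed
  have dim_eigenspace: "dim {v. M *v v = \<mu> *\<^sub>R v} = card {i. (a i)\<^sup>2 = \<mu>}" for \<mu>
  proof -
    have "dim ((*v) P ` {y. \<forall>i. (a i)\<^sup>2 \<noteq> \<mu> \<longrightarrow> y $ i = 0})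
        = dim {y :: real ^ 'n. \<forall>i. (a i)\<^sup>2 \<noteq> \<mu> \<longrightarrow> y $ i = 0}"
      using P_inj by (intro dim_image_eq) (auto intro: inj_on_subset)
    also have "\<dots>
        = dim {y :: real ^ 'n. \<forall>b\<in>Basis. b \<notin> (\<lambda>i. axis i 1) ` {i. (a i)\<^sup>2 = \<mu>} \<longrightarrow> y \<bullet> b = 0}"
      by (rule arg_cong[where f = dim]) (auto simp: Basis_vec_def inner_axis axis_eq_axis)
    also have "\<dots> = card ((\<lambda>i. axis i (1::real) :: real ^ 'n) ` {i. (a i)\<^sup>2 = \<mu>})"
      by (rule dim_substandard) (auto simp: Basis_vec_def)
    also have "\<dots> = card {i. (a i)\<^sup>2 = \<mu>}"
      by (intro card_image) (auto simp: inj_on_def axis_eq_axis)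
    finally show ?thesis
      by (simp add: eigenspace)
  qed
  have eigenvalues: "{\<mu>. \<exists>v. v \<noteq> 0 \<and> M *v v = \<mu> *\<^sub>R v} = range (\<lambda>i. (a i)\<^sup>2)"
  proof (intro set_eqI iffI)
    fix \<mu> assume "\<mu> \<in> {\<mu>. \<exists>v. v \<noteq> 0 \<and> M *v v = \<mu> *\<^sub>R v}"
    then obtain v where v: "v \<noteq> 0" "M *v v = \<mu> *\<^sub>R v"
      by auto
    define y where "y = transpose P *v v"
    have y: "v = P *v y"
      using orthogonal_matrix_cancel[OF P] by (simp add: y_def del: transpose_matrix_vector)
    with v(1) obtain i where "y $ i \<noteq> 0"
      by (metis matrix_vector_mult_0_right vec_eq_iff zero_index)
    with v(2) have "(a i)\<^sup>2 = \<mu>"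
      unfolding y eig by blast
    then show "\<mu> \<in> range (\<lambda>i. (a i)\<^sup>2)"
      by blast
  next
    fix \<mu> assume "\<mu> \<in> range (\<lambda>i. (a i)\<^sup>2)"
    then obtain i where i: "\<mu> = (a i)\<^sup>2" by blast
    have "P *v axis i 1 \<noteq> 0"
      using norm_orthogonal_matrix_mult[OF P, of "axis i 1"] by auto
    moreover have "M *v (P *v axis i 1) = \<mu> *\<^sub>R (P *v axis i 1)"
      unfolding eig by (auto simp: i axis_def)
    ultimately show "\<mu> \<in> {\<mu>. \<exists>v. v \<noteq> 0 \<and> M *v v = \<mu> *\<^sub>R v}" by blast
  qed
  have "singular_values A = (\<Sum>\<mu>\<in>range (\<lambda>i. (a i)\<^sup>2). replicate_mset (card {i. (a i)\<^sup>2 = \<mu>}) (sqrt \<mu>))"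
    unfolding singular_values_def M_def[symmetric] Let_def eigenvalues dim_eigenspace ..
  also have "\<dots> = image_mset a (mset_set UNIV)"
  proof (rule multiset_eqI)
    fix x
    have "count (\<Sum>\<mu>\<in>range (\<lambda>i. (a i)\<^sup>2). replicate_mset (card {i. (a i)\<^sup>2 = \<mu>}) (sqrt \<mu>)) x
        = (\<Sum>\<mu>\<in>range (\<lambda>i. (a i)\<^sup>2). if sqrt \<mu> = x then card {i. (a i)\<^sup>2 = \<mu>} else 0)"
      unfolding count_sum by (intro sum.cong) auto
    also have "\<dots> = (\<Sum>\<mu>\<in>range (\<lambda>i. (a i)\<^sup>2). if \<mu> = x\<^sup>2 then card {i. a i = x} else 0)"
    proof (rule sum.cong[OF refl])
      fix \<mu> assume "\<mu> \<in> range (\<lambda>i. (a i)\<^sup>2)"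
      then obtain i where i: "\<mu> = (a i)\<^sup>2" by blast
      show "(if sqrt \<mu> = x then card {i. (a i)\<^sup>2 = \<mu>} else 0)
          = (if \<mu> = x\<^sup>2 then card {i. a i = x} else 0)"
      proof (cases "x > 0")
        case True
        then have "sqrt \<mu> = x \<longleftrightarrow> \<mu> = x\<^sup>2" "{i. (a i)\<^sup>2 = x\<^sup>2} = {i. a i = x}"
          using a by (auto simp: i less_imp_le power2_eq_iff_nonneg)
        then show ?thesis by simp
      next
        case False
        then have "sqrt \<mu> \<noteq> x" "{i. a i = x} = {}"
          using a less_imp_le[OF a] by (auto simp: i)
        then show ?thesis by simp
      qed
    qed
    also have "\<dots> = card {i. a i = x}"
      by (auto simp: sum.delta)
    also have "\<dots> = count (image_mset a (mset_set UNIV)) x"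
      by (simp add: count_image_mset' sum.If_cases eq_commute)
    finally show "count (\<Sum>\<mu>\<in>range (\<lambda>i. (a i)\<^sup>2). replicate_mset (card {i. (a i)\<^sup>2 = \<mu>}) (sqrt \<mu>)) x
        = count (image_mset a (mset_set UNIV)) x" .
  qed
  finally show ?thesis
    by (simp add: A_def)
qed

section \<open>The singular value function\<close>

text \<open>Symmetric functions of the singular values can be computed from the diagonal of any singular value
  decomposition, whatever the order of its entries.\<close>

lemma prod_singular_value:
  fixes Q P :: "real ^ 'n ^ 'n" and f :: "real \<Rightarrow> 'b::comm_monoid_mult"
  assumes "orthogonal_matrix Q" "orthogonal_matrix P" "\<And>i. a i > 0"
    and A: "A = Q ** diagonal_matrix a ** transpose P"
  shows "(\<Prod>j = 1..CARD('n). f (singular_value A j)) = (\<Prod>i\<in>UNIV. f (a i))"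
proof -
  let ?l = "rev (sorted_list_of_multiset (singular_values A))"
  have mset: "mset ?l = image_mset a (mset_set UNIV)"
    using singular_values_decomposition[OF assms(1-3)] by (simp add: A)
  have len: "length ?l = CARD('n)"
    by (metis mset size_mset size_image_mset size_mset_set)
  have "(\<Prod>j = 1..CARD('n). f (singular_value A j)) = (\<Prod>j<CARD('n). f (?l ! j))"
    unfolding singular_value_def
    by (rule prod.reindex_bij_witness[of _ Suc "\<lambda>j. j - 1"]) auto
  also have "\<dots> = prod_mset (image_mset f (image_mset ((!) ?l) (mset_set {0..<length ?l})))"
    by (simp only: len multiset.map_comp prod_unfold_prod_mset o_def atLeast0LessThan)
  also have "image_mset ((!) ?l) (mset_set {0..<length ?l}) = mset ?l"
    by (metis map_nth mset_map mset_upt)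
  also have "prod_mset (image_mset f (mset ?l)) = (\<Prod>i\<in>UNIV. f (a i))"
    by (simp only: mset multiset.map_comp prod_unfold_prod_mset o_def)
  finally show ?thesis .
qed

lemma singular_value_in_range:
  fixes Q P :: "real ^ 'n ^ 'n"
  assumes "orthogonal_matrix Q" "orthogonal_matrix P" "\<And>i. a i > 0"
    and A: "A = Q ** diagonal_matrix a ** transpose P"
    and j: "j \<in> {1..CARD('n)}"
  shows "singular_value A j \<in> range a"
proof -
  let ?l = "rev (sorted_list_of_multiset (singular_values A))"
  have mset: "mset ?l = image_mset a (mset_set UNIV)"
    using singular_values_decomposition[OF assms(1-3)] by (simp add: A)
  have "length ?l = CARD('n)"
    by (metis mset size_mset size_image_mset size_mset_set)
  then have "singular_value A j \<in> set ?l"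
    using j unfolding singular_value_def by (intro nth_mem) auto
  also have "set ?l = range a"
    by (metis mset set_mset_mset finite finite_set_mset_mset_set set_image_mset)
  finally show ?thesis .
qed

lemma singular_value_antimono:
  fixes A :: "real ^ 'n ^ 'n"
  assumes "invertible A" and ij: "1 \<le> i" "i \<le> j" "j \<le> CARD('n)"
  shows "singular_value A j \<le> singular_value A i"
proof -
  obtain Q P a where svd: "orthogonal_matrix Q" "orthogonal_matrix P" "\<And>i. a i > 0"
    "A = Q ** diagonal_matrix a ** transpose P"
    using singular_value_decomposition[OF assms(1)] by metis
  let ?l = "sorted_list_of_multiset (singular_values A)"
  have "mset ?l = image_mset a (mset_set UNIV)"
    using singular_values_decomposition[OF svd(1-3)] by (simp add: svd(4))
  then have len: "length ?l = CARD('n)"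
    by (metis size_mset size_image_mset size_mset_set)
  have "sorted ?l"
    by simp
  then show ?thesis
    using ij len unfolding singular_value_def
    by (subst (1 2) rev_nth) (auto intro!: sorted_nth_mono)
qed

lemma singular_value_pos:
  fixes A :: "real ^ 'n ^ 'n"
  assumes "invertible A" "j \<in> {1..CARD('n)}"
  shows "singular_value A j > 0"
  using singular_value_decomposition[OF assms(1)] singular_value_in_range[OF _ _ _ _ assms(2)]
  by (metis imageE)

text \<open>Each singular value is the length of the image of a unit vector.\<close>

lemma singular_value_le:
  fixes A :: "real ^ 'n ^ 'n"
  assumes "invertible A" "\<And>x. norm (A *v x) \<le> c * norm x" "j \<in> {1..CARD('n)}"
  shows "singular_value A j \<le> c"
proof -
  obtain Q P a where svd: "orthogonal_matrix Q" "orthogonal_matrix P" "\<And>i. a i > 0"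
    "A = Q ** diagonal_matrix a ** transpose P"
    using singular_value_decomposition[OF assms(1)] by metis
  obtain i where i: "singular_value A j = a i"
    using singular_value_in_range[OF svd assms(3)] by blast
  have "A *v (P *v axis i 1) = Q *v (diagonal_matrix a *v axis i 1)"
    using orthogonal_matrix_cancel[OF svd(2)]
    by (simp add: svd(4) matrix_vector_mul_assoc[symmetric] del: transpose_matrix_vector)
  also have "diagonal_matrix a *v axis i 1 = a i *\<^sub>R axis i 1"
    by (auto simp: vec_eq_iff diagonal_matrix_mult_vector axis_def)
  finally have "norm (A *v (P *v axis i 1)) = a i"
    using less_imp_le[OF svd(3)[of i]] by (simp add: norm_orthogonal_matrix_mult[OF svd(1)])
  then show ?thesis
    using assms(2)[of "P *v axis i 1"] by (simp add: i norm_orthogonal_matrix_mult[OF svd(2)])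
qed

lemma prod_singular_value_eq_det:
  fixes A :: "real ^ 'n ^ 'n"
  assumes "invertible A"
  shows "(\<Prod>j = 1..CARD('n). singular_value A j) = \<bar>det A\<bar>"
proof -
  obtain Q P a where svd: "orthogonal_matrix Q" "orthogonal_matrix P" "\<And>i. a i > 0"
    "A = Q ** diagonal_matrix a ** transpose P"
    using singular_value_decomposition[OF assms(1)] by metis
  have "\<bar>det Q\<bar> = 1" "\<bar>det P\<bar> = 1"
    using det_orthogonal_matrix[OF svd(1)] det_orthogonal_matrix[OF svd(2)] by auto
  then have "\<bar>det A\<bar> = \<bar>\<Prod>i\<in>UNIV. a i\<bar>"
    by (simp add: svd(4) det_mul det_diagonal_matrix det_transpose abs_mult)
  also have "\<dots> = (\<Prod>i\<in>UNIV. a i)"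
    using svd(3) by (simp add: abs_prod less_imp_le)
  finally show ?thesis
    using prod_singular_value[OF svd, of "\<lambda>x. x"] by simp
qed

text \<open>The exponent of the \<open>j\<close>-th singular value in the singular value function at \<open>t\<close>. For \<open>t \<le> n\<close> the
  exponents are \<open>1, \<dots>, 1, t - m + 1, 0, \<dots>, 0\<close> and beyond \<open>n\<close> they all equal \<open>t / n\<close>. A single
  formula for all \<open>t \<ge> 0\<close> makes continuity and monotonicity in \<open>t\<close> evident, including at the integers
  and at \<open>t = n\<close>.\<close>

definition sv_exponent :: "nat \<Rightarrow> real \<Rightarrow> nat \<Rightarrow> real" where
  "sv_exponent n t j = max 0 (min 1 (t - real j + 1)) + max 0 (t / real n - 1)"

lemma sum_sv_exponent:
  assumes "n \<ge> 1" "t \<ge> 0"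
  shows "(\<Sum>j = 1..n. sv_exponent n t j) = t"
proof -
  have "(\<Sum>j = 1..k. max 0 (min 1 (t - real j + 1))) = min t (real k)" for k
    by (induction k) (use assms(2) in \<open>auto simp: min_def max_def\<close>)
  moreover have "real n * max 0 (t / real n - 1) = max 0 (t - real n)"
    using assms(1) by (auto simp: max_def field_simps)
  ultimately show ?thesis
    unfolding sv_exponent_def sum.distrib sum_constant card_atLeastAtMost by simp
qed

lemma sv_exponent_nonneg: "sv_exponent n t j \<ge> 0"
  by (simp add: sv_exponent_def)

lemma sv_exponent_mono: "t \<le> u \<Longrightarrow> sv_exponent n t j \<le> sv_exponent n u j"
  unfolding sv_exponent_def
  by (intro add_mono max.mono min.mono order_refl diff_right_mono divide_right_mono) auto

lemma sv_exponent_le_1: "0 \<le> t \<Longrightarrow> t \<le> real n \<Longrightarrow> sv_exponent n t j \<le> 1"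
  by (cases "n = 0") (auto simp: sv_exponent_def)

lemma singular_value_function_eq_prod:
  fixes A :: "real ^ 'n ^ 'n"
  assumes A: "invertible A" and t: "t \<ge> 0"
  shows "singular_value_function t A
    = (\<Prod>j = 1..CARD('n). singular_value A j powr sv_exponent CARD('n) t j)"
proof -
  let ?n = "CARD('n)"
  have n: "?n \<ge> 1"
    by (simp add: Suc_leI)
  note pos = singular_value_pos[OF A]
  consider "t = 0" | "0 < t" "t \<le> real ?n" | "t > real ?n"
    using t by linarith
  then show ?thesis
  proof cases
    case 1
    have "(\<Prod>j = 1..?n. singular_value A j powr sv_exponent ?n t j) = (\<Prod>j = 1..?n. 1)"
      using 1 pos by (intro prod.cong) (auto simp: sv_exponent_def less_imp_neq[symmetric])
    then show ?thesis
      by (simp add: singular_value_function_def 1)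
  next
    case 2
    define m where "m = nat \<lceil>t\<rceil>"
    have m: "1 \<le> m" "m \<le> ?n" "real m - 1 < t" "t \<le> real m"
      using 2 unfolding m_def by linarith+
    have last: "max 0 (t / real ?n - 1) = 0"
      using 2 by simp
    have "{1..?n} = {1..m - 1} \<union> ({m} \<union> {m + 1..?n})"
      using m by auto
    then have "(\<Prod>j = 1..?n. singular_value A j powr sv_exponent ?n t j)
       = (\<Prod>j = 1..m - 1. singular_value A j powr sv_exponent ?n t j) *
         (singular_value A m powr sv_exponent ?n t m *
         (\<Prod>j = m + 1..?n. singular_value A j powr sv_exponent ?n t j))"
      using m by (simp add: prod.union_disjoint)
    also have "(\<Prod>j = 1..m - 1. singular_value A j powr sv_exponent ?n t j)
        = (\<Prod>j = 1..m - 1. singular_value A j)"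
    proof (rule prod.cong[OF refl])
      fix j assume j: "j \<in> {1..m - 1}"
      then have "real j + 1 \<le> real m"
        using m(1) by auto
      then have "sv_exponent ?n t j = 1"
        unfolding sv_exponent_def last using m by (simp add: min_def)
      moreover have "singular_value A j > 0"
        using j m by (intro pos) auto
      ultimately show "singular_value A j powr sv_exponent ?n t j = singular_value A j"
        by simp
    qed
    also have "(\<Prod>j = m + 1..?n. singular_value A j powr sv_exponent ?n t j) = (\<Prod>j = m + 1..?n. 1)"
    proof (rule prod.cong[OF refl])
      fix j assume j: "j \<in> {m + 1..?n}"
      then have "sv_exponent ?n t j = 0"
        unfolding sv_exponent_def last using m by auto
      moreover have "singular_value A j > 0"
        using j m by (intro pos) auto
      ultimately show "singular_value A j powr sv_exponent ?n t j = 1"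
        by simp
    qed
    also have "sv_exponent ?n t m = t - real m + 1"
      unfolding sv_exponent_def last using m by simp
    finally show ?thesis
      using 2 by (simp add: singular_value_function_def m_def[symmetric])
  next
    case 3
    have "(\<Prod>j = 1..?n. singular_value A j powr sv_exponent ?n t j)
        = (\<Prod>j = 1..?n. singular_value A j powr (t / real ?n))"
      using 3 by (auto simp: sv_exponent_def)
    also have "\<dots> = (\<Prod>j = 1..?n. singular_value A j) powr (t / real ?n)"
      by (intro prod_powr_distrib[symmetric])
    also have "\<dots> = \<bar>det A\<bar> powr (t / real ?n)"
      by (simp only: prod_singular_value_eq_det[OF A])
    finally show ?thesis
      using 3 t by (simp add: singular_value_function_def)
  qed
qed

lemma singular_value_function_pos:
  fixes A :: "real ^ 'n ^ 'n"
  assumes "invertible A" "t \<ge> 0"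
  shows "singular_value_function t A > 0"
  unfolding singular_value_function_eq_prod[OF assms]
  by (intro prod_pos ballI) (metis singular_value_pos[OF assms(1)] powr_gt_zero less_irrefl)

lemma continuous_on_singular_value_function:
  fixes A :: "real ^ 'n ^ 'n"
  assumes "invertible A"
  shows "continuous_on {0..} (\<lambda>t. singular_value_function t A)"
proof -
  have "continuous_on {0..} (\<lambda>t. \<Prod>j = 1..CARD('n). singular_value A j powr sv_exponent CARD('n) t j)"
    unfolding sv_exponent_def using singular_value_pos[OF assms]
    by (intro continuous_intros) (auto simp: less_imp_neq[symmetric])
  then show ?thesis
    by (rule continuous_on_eq) (simp add: singular_value_function_eq_prod[OF assms])
qed

text \<open>Every exponent increases with \<open>t\<close>, the exponents add up to \<open>t\<close>, and no singular value exceeds the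
  Lipschitz constant \<open>c\<close>.\<close>

lemma singular_value_function_decay:
  fixes A :: "real ^ 'n ^ 'n"
  assumes A: "invertible A" and c: "c > 0" "\<And>x. norm (A *v x) \<le> c * norm x"
    and t: "t \<ge> 0" "h \<ge> 0"
  shows "singular_value_function (t + h) A \<le> c powr h * singular_value_function t A"
proof -
  let ?n = "CARD('n)"
  let ?e = "sv_exponent ?n"
  have n: "?n \<ge> 1"
    by (simp add: Suc_leI)
  have "singular_value_function (t + h) A
      = (\<Prod>j = 1..?n. singular_value A j powr (?e (t + h) j - ?e t j) * singular_value A j powr ?e t j)"
    using t A by (subst singular_value_function_eq_prod) (simp_all add: powr_add[symmetric])
  also have "\<dots> \<le> (\<Prod>j = 1..?n. c powr (?e (t + h) j - ?e t j) * singular_value A j powr ?e t j)"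
  proof (intro prod_mono conjI mult_right_mono powr_mono2)
    fix j assume j: "j \<in> {1..?n}"
    show "0 \<le> ?e (t + h) j - ?e t j"
      using sv_exponent_mono[of t "t + h" ?n j] t by simp
    show "0 \<le> singular_value A j" "singular_value A j \<le> c"
      using singular_value_pos[OF A j] singular_value_le[OF A c(2) j] by auto
  qed auto
  also have "\<dots> = (\<Prod>j = 1..?n. c powr (?e (t + h) j - ?e t j)) * singular_value_function t A"
    using A t by (simp add: prod.distrib singular_value_function_eq_prod)
  also have "(\<Prod>j = 1..?n. c powr (?e (t + h) j - ?e t j)) = c powr (\<Sum>j = 1..?n. ?e (t + h) j - ?e t j)"
    using c by (simp add: powr_sum)
  also have "(\<Sum>j = 1..?n. ?e (t + h) j - ?e t j) = h"
    unfolding sum_subtractf using t sum_sv_exponent[OF n, of t] sum_sv_exponent[OF n, of "t + h"] by simp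
  finally show ?thesis .
qed

text \<open>Up to constants this is the number of balls of radius \<open>\<delta>\<close> needed to cover the image of the unit ball:
  an axis of the image ellipsoid contributes the ratio of its half-length to \<open>\<delta>\<close> if it is longer than
  \<open>\<delta>\<close>, and a factor 1 otherwise.\<close>

definition elongation :: "real ^ 'n ^ 'n \<Rightarrow> real \<Rightarrow> real" where
  "elongation A \<delta> = (\<Prod>j = 1..CARD('n). max (singular_value A j / \<delta>) 1)"

text \<open>Since the exponents add up to \<open>t\<close>, rescaling all singular values by \<open>\<delta>\<close> costs the factor
  \<open>\<delta> powr t\<close>. This is what makes the comparison with \<open>elongation\<close> a factor by factor estimate.\<close>

lemma singular_value_function_scaled:
  fixes A :: "real ^ 'n ^ 'n"
  assumes A: "invertible A" and "t \<ge> 0" and d: "\<delta> > 0"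
  shows "singular_value_function t A
    = \<delta> powr t * (\<Prod>j = 1..CARD('n). (singular_value A j / \<delta>) powr sv_exponent CARD('n) t j)"
proof -
  let ?n = "CARD('n)"
  have n: "?n \<ge> 1"
    by (simp add: Suc_leI)
  have "\<delta> powr t = \<delta> powr (\<Sum>j = 1..?n. sv_exponent ?n t j)"
    using n assms(2) by (simp only: sum_sv_exponent)
  also have "\<dots> = (\<Prod>j = 1..?n. \<delta> powr sv_exponent ?n t j)"
    using d by (simp add: powr_sum)
  finally show ?thesis
    using d singular_value_pos[OF A]
    by (simp add: singular_value_function_eq_prod[OF A assms(2)] prod.distrib[symmetric]
        powr_mult[symmetric] less_imp_le cong: prod.cong)
qed

text \<open>For \<open>t \<le> n\<close> all exponents lie between 0 and 1, and \<open>x\<close> raised to such an exponent is at most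
  \<open>max x 1\<close>.\<close>

lemma singular_value_function_le_elongation:
  fixes A :: "real ^ 'n ^ 'n"
  assumes A: "invertible A" and t: "0 \<le> t" "t \<le> real CARD('n)" and d: "\<delta> > 0"
  shows "singular_value_function t A \<le> \<delta> powr t * elongation A \<delta>"
  unfolding singular_value_function_scaled[OF A t(1) d] elongation_def
proof (intro mult_left_mono prod_mono conjI)
  fix j assume "j \<in> {1..CARD('n)}"
  then have pos: "singular_value A j / \<delta> > 0"
    using singular_value_pos[OF A] d by simp
  have e: "0 \<le> sv_exponent CARD('n) t j" "sv_exponent CARD('n) t j \<le> 1"
    using sv_exponent_nonneg sv_exponent_le_1 t by auto
  have "(singular_value A j / \<delta>) powr sv_exponent CARD('n) t j
      \<le> max (singular_value A j / \<delta>) 1 powr sv_exponent CARD('n) t j"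
    using pos e by (intro powr_mono2) auto
  also have "\<dots> \<le> max (singular_value A j / \<delta>) 1 powr 1"
    using e by (intro powr_mono) auto
  finally show "(singular_value A j / \<delta>) powr sv_exponent CARD('n) t j \<le> max (singular_value A j / \<delta>) 1"
    by simp
qed auto

text \<open>The previous bound is attained at the singular value of index \<open>m = \<lceil>t\<rceil>\<close>: the larger ones have exponent
  1 and ratio at least 1, the smaller ones have exponent 0 and ratio at most 1. For \<open>t = 0\<close> the index
  \<open>m = 1\<close> serves. Together the two lemmas say that the singular value function is the infimum over \<open>\<delta>\<close>
  of \<open>\<delta> powr t * elongation A \<delta>\<close>.\<close>

lemma singular_value_function_eq_elongation:
  fixes A :: "real ^ 'n ^ 'n"
  assumes A: "invertible A" and t: "0 \<le> t" "t \<le> real CARD('n)"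
  obtains m where "m \<in> {1..CARD('n)}"
    "singular_value_function t A = singular_value A m powr t * elongation A (singular_value A m)"
proof
  let ?n = "CARD('n)"
  define m where "m = max 1 (nat \<lceil>t\<rceil>)"
  have n: "?n \<ge> 1"
    by (simp add: Suc_leI)
  have m: "1 \<le> m" "m \<le> ?n" "real m - 1 \<le> t" "t \<le> real m"
    using t n unfolding m_def by linarith+
  then show mem: "m \<in> {1..?n}"
    by simp
  note pos = singular_value_pos[OF A]
  have last: "max 0 (t / real ?n - 1) = 0"
    using t by simp
  have "(\<Prod>j = 1..?n. (singular_value A j / singular_value A m) powr sv_exponent ?n t j)
      = elongation A (singular_value A m)"
    unfolding elongation_def
  proof (rule prod.cong[OF refl])
    fix j assume j: "j \<in> {1..?n}"
    consider "j < m" | "j = m" | "j > m" by linarith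
    then show "(singular_value A j / singular_value A m) powr sv_exponent ?n t j
        = max (singular_value A j / singular_value A m) 1"
    proof cases
      case 1
      then have "real j + 1 \<le> real m" by simp
      then have "sv_exponent ?n t j = 1"
        unfolding sv_exponent_def last using m by (simp add: min_def)
      moreover have "1 \<le> singular_value A j / singular_value A m"
        using singular_value_antimono[OF A, of j m] 1 j m pos[OF mem] by simp
      ultimately show ?thesis
        using pos[OF mem] pos[OF j] by simp
    next
      case 2
      then show ?thesis using pos[OF mem] by simp
    next
      case 3
      then have "sv_exponent ?n t j = 0"
        unfolding sv_exponent_def last using m by auto
      moreover have "singular_value A j / singular_value A m \<le> 1"
        using singular_value_antimono[OF A, of m j] 3 j m pos[OF mem] by simp
      moreover have "singular_value A j / singular_value A m > 0"
        using pos[OF mem] pos[OF j] by simp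
      ultimately show ?thesis
        using pos[OF mem] pos[OF j] by simp
    qed
  qed
  then show "singular_value_function t A = singular_value A m powr t * elongation A (singular_value A m)"
    using singular_value_function_scaled[OF A t(1) pos[OF mem]] by simp
qed

section \<open>Coverings by balls\<close>

definition ball_cover :: "real \<Rightarrow> nat \<Rightarrow> 'a::metric_space set \<Rightarrow> bool" where
  "ball_cover r k X \<longleftrightarrow> (\<exists>P. finite P \<and> card P \<le> k \<and> X \<subseteq> (\<Union>p\<in>P. cball p r))"

lemma ball_cover_mono:
  assumes "ball_cover r k X" "r \<le> r'" "k \<le> k'" "Y \<subseteq> X"
  shows "ball_cover r' k' Y"
proof -
  obtain P where P: "finite P" "card P \<le> k" "X \<subseteq> (\<Union>p\<in>P. cball p r)"
    using assms(1) unfolding ball_cover_def by blast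
  have "(\<Union>p\<in>P. cball p r) \<subseteq> (\<Union>p\<in>P. cball p r')"
    using assms(2) by (intro UN_mono order_refl subset_cball)
  then show ?thesis
    unfolding ball_cover_def using P assms(3,4) by (intro exI[of _ P]) auto
qed

lemma ball_cover_UN:
  assumes "finite I" "\<And>i. i \<in> I \<Longrightarrow> ball_cover r (k i) (X i)"
  shows "ball_cover r (\<Sum>i\<in>I. k i) (\<Union>i\<in>I. X i)"
proof -
  obtain P where P: "\<And>i. i \<in> I \<Longrightarrow> finite (P i) \<and> card (P i) \<le> k i \<and> X i \<subseteq> (\<Union>p\<in>P i. cball p r)"
    using assms(2) unfolding ball_cover_def by metis
  have "card (\<Union>i\<in>I. P i) \<le> (\<Sum>i\<in>I. k i)"
    using card_UN_le[OF assms(1), of P] sum_mono[of I "\<lambda>i. card (P i)" k] P by fastforce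
  moreover have "(\<Union>i\<in>I. X i) \<subseteq> (\<Union>p\<in>(\<Union>i\<in>I. P i). cball p r)"
    using P by (intro UN_least) (force dest: subsetD)
  moreover have "finite (\<Union>i\<in>I. P i)"
    using P assms(1) by blast
  ultimately show ?thesis
    unfolding ball_cover_def by blast
qed

lemma ball_cover_Un:
  assumes "ball_cover r k X" "ball_cover r l Y"
  shows "ball_cover r (k + l) (X \<union> Y)"
  using ball_cover_UN[of "{True, False}" r "\<lambda>b. if b then k else l" "\<lambda>b. if b then X else Y"] assms
  by (simp add: Un_commute)

lemma ball_cover_nonexpansive_image:
  assumes "ball_cover r k X" and f: "\<And>x y. dist (f x) (f y) \<le> dist x y"
  shows "ball_cover r k (f ` X)"
proof -
  obtain P where P: "finite P" "card P \<le> k" "X \<subseteq> (\<Union>p\<in>P. cball p r)"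
    using assms(1) unfolding ball_cover_def by blast
  have "f ` X \<subseteq> (\<Union>q\<in>f ` P. cball q r)"
  proof (rule image_subsetI)
    fix x assume "x \<in> X"
    then obtain p where "p \<in> P" "dist p x \<le> r"
      using P(3) by auto
    then show "f x \<in> (\<Union>q\<in>f ` P. cball q r)"
      using order_trans[OF f[of p x]] by auto
  qed
  then show ?thesis
    unfolding ball_cover_def using P card_image_le[of P f]
    by (intro exI[of _ "f ` P"]) auto
qed

text \<open>Coverings compose: cover \<open>X\<close> at scale \<open>\<epsilon>\<close> and then cover the image of each of these balls, which is a
  translate of the image of the unit ball scaled by \<open>\<epsilon>\<close>. Both the submultiplicativity of the singular
  value function and the renewal inequality come from this lemma.\<close>

lemma ball_cover_affine_image:
  fixes A :: "real ^ 'n ^ 'n"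
  assumes X: "ball_cover \<epsilon> k X" and A: "ball_cover \<delta> l ((*v) A ` cball 0 1)" and "\<epsilon> > 0"
  shows "ball_cover (\<delta> * \<epsilon>) (l * k) ((\<lambda>x. A *v x + b) ` X)"
proof -
  obtain P where P: "finite P" "card P \<le> k" "X \<subseteq> (\<Union>p\<in>P. cball p \<epsilon>)"
    using X unfolding ball_cover_def by blast
  obtain P' where P': "finite P'" "card P' \<le> l" "(*v) A ` cball 0 1 \<subseteq> (\<Union>p\<in>P'. cball p \<delta>)"
    using A unfolding ball_cover_def by blast
  let ?g = "\<lambda>(q, p). A *v p + b + \<epsilon> *\<^sub>R q"
  have "(\<lambda>x. A *v x + b) ` X \<subseteq> (\<Union>z\<in>?g ` (P' \<times> P). cball z (\<delta> * \<epsilon>))"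
  proof (rule image_subsetI)
    fix x assume "x \<in> X"
    then obtain p where p: "p \<in> P" "dist p x \<le> \<epsilon>"
      using P(3) by auto
    define u where "u = (1 / \<epsilon>) *\<^sub>R (x - p)"
    have x: "x = p + \<epsilon> *\<^sub>R u"
      using \<open>\<epsilon> > 0\<close> by (simp add: u_def)
    have "norm u \<le> 1"
      using p(2) \<open>\<epsilon> > 0\<close> by (simp add: u_def dist_norm norm_minus_commute)
    then obtain q where q: "q \<in> P'" "dist q (A *v u) \<le> \<delta>"
      using subsetD[OF P'(3), of "A *v u"] by auto
    have "?g (q, p) - (A *v x + b) = \<epsilon> *\<^sub>R (q - A *v u)"
      by (simp add: x matrix_vector_right_distrib matrix_vector_mult_scaleR scaleR_right_diff_distrib)
    then have "dist (?g (q, p)) (A *v x + b) = \<epsilon> * dist q (A *v u)"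
      using \<open>\<epsilon> > 0\<close> by (simp only: dist_norm norm_scaleR abs_of_pos)
    also have "\<dots> \<le> \<epsilon> * \<delta>"
      using q(2) \<open>\<epsilon> > 0\<close> by simp
    finally have "A *v x + b \<in> cball (?g (q, p)) (\<delta> * \<epsilon>)"
      by (simp add: mult.commute)
    then show "A *v x + b \<in> (\<Union>z\<in>?g ` (P' \<times> P). cball z (\<delta> * \<epsilon>))"
      using p(1) q(1) by blast
  qed
  moreover have "card (?g ` (P' \<times> P)) \<le> l * k"
    using P(1,2) P'(1,2) card_image_le[of "P' \<times> P" ?g] mult_le_mono[of "card P'" l "card P" k]
    by (simp add: card_cartesian_product)
  ultimately show ?thesis
    unfolding ball_cover_def using P(1) P'(1) by (intro exI[of _ "?g ` (P' \<times> P)"]) auto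
qed

text \<open>A diagonal matrix scales the coordinates separately, so the volume formula is the change of
  variables for coordinatewise scalings.\<close>

lemma measure_diagonal_image_cball:
  fixes b :: "'n::finite \<Rightarrow> real"
  assumes b: "\<And>i. b i > 0"
  shows "measure lebesgue ((*v) (diagonal_matrix b) ` cball 0 1)
    = (\<Prod>i\<in>UNIV. b i) * unit_ball_vol (real CARD('n))"
    and "(*v) (diagonal_matrix b) ` cball 0 1 \<in> lmeasurable"
proof -
  let ?D = "diagonal_matrix b"
  define c :: "real ^ 'n \<Rightarrow> real" where "c j = (?D *v j) \<bullet> j" for j
  define T :: "real ^ 'n \<Rightarrow> real ^ 'n" where "T x = 0 + (\<Sum>j\<in>Basis. (c j * (x \<bullet> j)) *\<^sub>R j)" for x
  have c_axis: "c (axis i 1) = b i" for i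
    by (simp add: c_def inner_axis diagonal_matrix_mult_vector)
  have Basis_eq: "(Basis :: (real ^ 'n) set) = range (\<lambda>i. axis i 1)"
    by (auto simp: Basis_vec_def)
  have inj: "inj (\<lambda>i :: 'n. axis i (1 :: real))"
    by (auto simp: inj_def axis_eq_axis)
  have T_eq: "T x = ?D *v x" for x
  proof -
    have "T x = (\<Sum>i\<in>UNIV. (b i * x $ i) *\<^sub>R axis i 1)"
      unfolding T_def Basis_eq by (simp add: sum.reindex[OF inj] c_axis inner_axis)
    also have "\<dots> = ?D *v x"
      by (simp add: vec_eq_iff diagonal_matrix_mult_vector axis_def if_distrib cong: if_cong)
    finally show ?thesis .
  qed
  have c_ne: "c j \<noteq> 0" if "j \<in> Basis" for j
    using that b less_imp_neq[OF b] by (auto simp: Basis_eq c_axis)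
  have prod_c: "(\<Prod>j\<in>Basis. \<bar>c j\<bar>) = (\<Prod>i\<in>UNIV. b i)"
    unfolding Basis_eq using b by (simp add: prod.reindex[OF inj] c_axis abs_of_pos)
  have cpt: "compact (T ` cball 0 1)"
    unfolding T_eq[abs_def] by (intro compact_continuous_image compact_cball linear_continuous_on
        matrix_vector_mul_bounded_linear)
  then have meas [measurable]: "T ` cball 0 1 \<in> sets borel"
    by (rule borel_compact)
  have "inj T"
  proof (rule injI)
    fix x y assume "T x = T y"
    then have "b i * x $ i = b i * y $ i" for i
      unfolding T_eq by (metis diagonal_matrix_mult_vector)
    then show "x = y"
      using less_imp_neq[OF b] by (auto simp: vec_eq_iff)
  qed
  have T_meas [measurable]: "T \<in> borel \<rightarrow>\<^sub>M borel"
    by (simp add: T_def[abs_def])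
  have "emeasure lborel (T ` cball 0 1)
      = emeasure (density (distr lborel borel T) (\<lambda>_. (\<Prod>j\<in>Basis. \<bar>c j\<bar>))) (T ` cball 0 1)"
    unfolding T_def by (subst lborel_affine_euclidean[OF c_ne, of _ 0]) auto
  also have "\<dots> = ennreal (\<Prod>i\<in>UNIV. b i) * emeasure lborel (cball (0 :: real ^ 'n) 1)"
    unfolding prod_c using \<open>inj T\<close>
    by (simp add: emeasure_density nn_integral_cmult_indicator emeasure_distr inj_vimage_image_eq)
  finally have "emeasure lborel (T ` cball 0 1)
      = ennreal (\<Prod>i\<in>UNIV. b i) * emeasure lborel (cball (0 :: real ^ 'n) 1)" .
  then have "measure lborel (T ` cball 0 1) = (\<Prod>i\<in>UNIV. b i) * unit_ball_vol (real CARD('n))"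
    using b by (simp add: measure_def enn2real_mult prod_nonneg less_imp_le emeasure_cball)
  then show "measure lebesgue ((*v) ?D ` cball 0 1) = (\<Prod>i\<in>UNIV. b i) * unit_ball_vol (real CARD('n))"
    using meas by (simp add: T_eq)
  show "(*v) ?D ` cball 0 1 \<in> lmeasurable"
    using lmeasurable_compact[OF cpt] by (simp add: T_eq)
qed

lemma prod_max_scale:
  fixes a :: "'n::finite \<Rightarrow> real"
  assumes "\<delta> > 0"
  shows "(\<Prod>i\<in>UNIV. max (a i) \<delta>) = \<delta> ^ CARD('n) * (\<Prod>i\<in>UNIV. max (a i / \<delta>) 1)"
proof -
  have "(\<Prod>i\<in>UNIV. max (a i) \<delta>) = (\<Prod>i\<in>UNIV. \<delta> * max (a i / \<delta>) 1)"
    using assms by (intro prod.cong) (auto simp: max_def)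
  then show ?thesis
    by (simp add: prod.distrib)
qed

text \<open>Enlarging the balls of a covering by the factor 2 covers the \<open>\<delta>\<close>-neighbourhood of the ellipsoid. That
  neighbourhood contains the ellipsoid with half-axes \<open>max (a i) \<delta>\<close>, whose volume bounds the number of
  balls from below.\<close>

lemma diagonal_ball_cover_lower:
  fixes a :: "'n::finite \<Rightarrow> real"
  assumes cover: "ball_cover \<delta> k ((*v) (diagonal_matrix a) ` cball 0 1)" and d: "\<delta> > 0"
    and a: "\<And>i. a i > 0"
  shows "(\<Prod>i\<in>UNIV. max (a i / \<delta>) 1) \<le> 2 ^ CARD('n) * real k"
proof -
  let ?n = "CARD('n)"
  let ?V = "unit_ball_vol (real ?n)"
  let ?D = "diagonal_matrix a"
  let ?D' = "diagonal_matrix (\<lambda>i. max (a i) \<delta>)"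
  obtain P where P: "finite P" "card P \<le> k" "(*v) ?D ` cball 0 1 \<subseteq> (\<Union>p\<in>P. cball p \<delta>)"
    using cover unfolding ball_cover_def by blast
  have sub: "(*v) ?D' ` cball 0 1 \<subseteq> (\<Union>p\<in>P. cball p (2 * \<delta>))"
  proof (rule image_subsetI)
    fix x :: "real ^ 'n" assume x: "x \<in> cball 0 1"
    \<comment> \<open>The long axes are taken from the ellipsoid itself, the short ones from the ball of radius \<open>\<delta>\<close>.\<close>
    define y z :: "real ^ 'n" where "y = (\<chi> i. if a i \<ge> \<delta> then x $ i else 0)"
      and "z = (\<chi> i. if a i \<ge> \<delta> then 0 else x $ i)"
    have le: "norm y \<le> norm x" "norm z \<le> norm x"
      by (intro norm_le_componentwise_cart; simp add: y_def z_def)+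
    have split: "?D' *v x = ?D *v y + \<delta> *\<^sub>R z"
      by (auto simp: vec_eq_iff diagonal_matrix_mult_vector y_def z_def max_def)
    obtain p where p: "p \<in> P" "dist p (?D *v y) \<le> \<delta>"
      using subsetD[OF P(3), of "?D *v y"] le(1) x by auto
    have "dist p (?D' *v x) \<le> dist p (?D *v y) + norm (\<delta> *\<^sub>R z)"
      unfolding split using dist_triangle[of p "?D *v y + \<delta> *\<^sub>R z" "?D *v y"] by (simp add: dist_norm)
    also have "norm (\<delta> *\<^sub>R z) \<le> \<delta> * 1"
      using le(2) x d by simp
    finally have "?D' *v x \<in> cball p (2 * \<delta>)"
      using p(2) by simp
    then show "?D' *v x \<in> (\<Union>p\<in>P. cball p (2 * \<delta>))"
      using p(1) by blast
  qed
  have D': "\<And>i. max (a i) \<delta> > 0"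
    using d by auto
  have "(\<Prod>i\<in>UNIV. max (a i) \<delta>) * ?V \<le> measure lebesgue (\<Union>p\<in>P. cball p (2 * \<delta>))"
    unfolding measure_diagonal_image_cball(1)[OF D', symmetric] using sub P(1)
    by (intro measure_mono_fmeasurable fmeasurableD measure_diagonal_image_cball(2)[OF D']
        fmeasurable.finite_UN) auto
  also have "\<dots> \<le> (\<Sum>p\<in>P. measure lebesgue (cball p (2 * \<delta>)))"
    using P(1) by (intro measure_UNION_le) auto
  also have "\<dots> = real (card P) * (?V * (2 * \<delta>) ^ ?n)"
    using d by (simp add: content_cball)
  also have "\<dots> \<le> real k * (?V * (2 * \<delta>) ^ ?n)"
    using P(2) d by (intro mult_right_mono) auto
  finally have "(\<Prod>i\<in>UNIV. max (a i / \<delta>) 1) * (\<delta> ^ ?n * ?V) \<le> (2 ^ ?n * real k) * (\<delta> ^ ?n * ?V)"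
    unfolding prod_max_scale[OF d] by (simp add: power_mult_distrib mult_ac)
  then show ?thesis
    by (rule mult_right_le_imp_le) (use d in simp)
qed

text \<open>A maximal \<open>\<delta>\<close>-separated subset of the ellipsoid yields a covering. The balls of radius \<open>\<delta> / 2\<close> around
  its points are disjoint and lie in the ellipsoid with half-axes \<open>b i = 2 n max (a i) \<delta>\<close>, so there
  cannot be many of them.\<close>

lemma diagonal_ball_cover_upper:
  fixes a :: "'n::finite \<Rightarrow> real"
  assumes d: "\<delta> > 0" and a: "\<And>i. a i > 0"
  obtains k where "ball_cover \<delta> k ((*v) (diagonal_matrix a) ` cball 0 1)"
    "real k \<le> (4 * real CARD('n)) ^ CARD('n) * (\<Prod>i\<in>UNIV. max (a i / \<delta>) 1)"
proof -
  let ?n = "CARD('n)"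
  let ?V = "unit_ball_vol (real ?n)"
  let ?E = "(*v) (diagonal_matrix a) ` cball 0 1"
  let ?M = "(4 * real ?n) ^ ?n * (\<Prod>i\<in>UNIV. max (a i / \<delta>) 1)"
  define b where "b i = 2 * real ?n * max (a i) \<delta>" for i
  have n: "?n > 0"
    by simp
  have b: "\<And>i. b i > 0"
    using d by (auto simp: b_def max_def)
  define sep where "sep X \<longleftrightarrow> finite X \<and> X \<subseteq> ?E \<and> pairwise (\<lambda>x y. \<delta> < dist x y) X" for X
  have bound: "real (card X) \<le> ?M" if "sep X" for X
  proof -
    have X: "finite X" "X \<subseteq> ?E" "pairwise (\<lambda>x y. \<delta> < dist x y) X"
      using that by (auto simp: sep_def)
    have sub: "(\<Union>x\<in>X. cball x (\<delta> / 2)) \<subseteq> (*v) (diagonal_matrix b) ` cball 0 1"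
    proof (rule UN_least, rule subsetI)
      fix x z assume "x \<in> X" and z: "z \<in> cball x (\<delta> / 2)"
      then obtain u where u: "u \<in> cball 0 1" "x = diagonal_matrix a *v u"
        using X(2) by blast
      define y :: "real ^ 'n" where "y = (\<chi> i. z $ i / b i)"
      have "\<bar>y $ i\<bar> \<le> 1 / real ?n" for i
      proof -
        have "\<bar>z $ i - x $ i\<bar> \<le> \<delta> / 2"
          using component_le_norm_cart[of "z - x" i] z by (simp add: dist_norm norm_minus_commute)
        moreover have "\<bar>x $ i\<bar> \<le> a i"
        proof -
          have "\<bar>u $ i\<bar> \<le> 1"
            using component_le_norm_cart[of u i] u(1) by simp
          then show ?thesis
            using a[of i] by (simp add: u(2) diagonal_matrix_mult_vector abs_mult)
        qed
        ultimately have "\<bar>z $ i\<bar> \<le> 2 * max (a i) \<delta>"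
          using d by linarith
        then have "\<bar>z $ i\<bar> * real ?n \<le> b i"
          by (simp add: b_def mult_right_mono)
        then show ?thesis
          using b[of i] n by (simp add: y_def abs_divide field_simps)
      qed
      then have "(\<Sum>i\<in>UNIV. \<bar>y $ i\<bar>) \<le> (\<Sum>i\<in>(UNIV :: 'n set). 1 / real ?n)"
        by (intro sum_mono) auto
      then have "norm y \<le> 1"
        using norm_le_l1_cart[of y] by simp
      moreover have "z = diagonal_matrix b *v y"
        using less_imp_neq[OF b] by (auto simp: vec_eq_iff diagonal_matrix_mult_vector y_def)
      ultimately show "z \<in> (*v) (diagonal_matrix b) ` cball 0 1"
        by auto
    qed
    have disj: "disjoint_family_on (\<lambda>x. cball x (\<delta> / 2)) X"
    proof (unfold disjoint_family_on_def, intro ballI impI)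
      fix x y assume "x \<in> X" "y \<in> X" "x \<noteq> y"
      then have "\<delta> < dist x y"
        using X(3) by (auto simp: pairwise_def)
      moreover have "dist x y \<le> dist x z + dist y z" for z
        by (rule dist_triangle2)
      ultimately show "cball x (\<delta> / 2) \<inter> cball y (\<delta> / 2) = {}"
        by (smt (verit) disjoint_iff mem_cball field_sum_of_halves)
    qed
    have "real (card X) * (?V * (\<delta> / 2) ^ ?n) = (\<Sum>x\<in>X. measure lebesgue (cball x (\<delta> / 2)))"
      using d by (simp add: content_cball)
    also have "\<dots> = measure lebesgue (\<Union>x\<in>X. cball x (\<delta> / 2))"
      using X(1) disj by (intro measure_finite_Union[symmetric])
        (auto simp: emeasure_eq_measure2[OF lmeasurable_cball])
    also have "\<dots> \<le> (\<Prod>i\<in>UNIV. b i) * ?V"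
      unfolding measure_diagonal_image_cball(1)[OF b, symmetric] using sub X(1)
      by (intro measure_mono_fmeasurable measure_diagonal_image_cball(2)[OF b]) auto
    also have "(\<Prod>i\<in>UNIV. b i) = (2 * real ?n) ^ ?n * (\<Prod>i\<in>UNIV. max (a i) \<delta>)"
      by (simp add: b_def prod.distrib)
    also have "\<dots> * ?V = ?M * (?V * (\<delta> / 2) ^ ?n)"
    proof -
      have "(4 :: real) ^ ?n = 2 ^ ?n * 2 ^ ?n"
        by (simp add: power_mult_distrib[symmetric])
      then show ?thesis
        unfolding prod_max_scale[OF d] by (simp add: power_mult_distrib power_divide mult_ac)
    qed
    finally show ?thesis
      by (rule mult_right_le_imp_le) (use d in simp)
  qed
  have "sep {}"
    by (simp add: sep_def)
  moreover have "card X \<le> nat \<lfloor>?M\<rfloor>" if "sep X" for X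
    using bound[OF that] by linarith
  ultimately obtain X where X: "sep X" and max: "\<And>Y. sep Y \<Longrightarrow> card Y \<le> card X"
    using ex_has_greatest_nat[of sep "{}" card "Suc (nat \<lfloor>?M\<rfloor>)"] by (auto simp: less_Suc_eq_le)
  have "?E \<subseteq> (\<Union>x\<in>X. cball x \<delta>)"
  proof (rule subsetI, rule ccontr)
    fix y assume y: "y \<in> ?E" "y \<notin> (\<Union>x\<in>X. cball x \<delta>)"
    then have far: "\<delta> < dist x y" if "x \<in> X" for x
      using that by force
    have "sep (insert y X)"
      using X y(1) far by (auto simp: sep_def pairwise_insert dist_commute)
    moreover have "y \<notin> X"
      using far[of y] d by auto
    ultimately show False
      using max[of "insert y X"] X by (simp add: sep_def)
  qed
  then have "ball_cover \<delta> (card X) ?E"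
    using X unfolding ball_cover_def sep_def by blast
  then show thesis
    using bound[OF X] by (rule that)
qed

lemma ball_cover_orthogonal_image:
  fixes Q :: "real ^ 'n ^ 'n"
  assumes Q: "orthogonal_matrix Q"
  shows "ball_cover r k ((*v) Q ` X) \<longleftrightarrow> ball_cover r k X"
proof
  have isometry: "dist (Q *v x) (Q *v y) = dist x y" if "orthogonal_matrix Q" for x y and Q :: "real ^ 'n ^ 'n"
    unfolding dist_norm matrix_vector_mult_diff_distrib[symmetric]
    by (rule norm_orthogonal_matrix_mult[OF that])
  assume "ball_cover r k ((*v) Q ` X)"
  then have "ball_cover r k ((*v) (transpose Q) ` (*v) Q ` X)"
    by (rule ball_cover_nonexpansive_image)
      (use isometry[of "transpose Q"] Q in \<open>simp del: transpose_matrix_vector\<close>)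
  then show "ball_cover r k X"
    using orthogonal_matrix_cancel(1)[OF Q] by (simp add: image_image del: transpose_matrix_vector)
next
  assume "ball_cover r k X"
  then show "ball_cover r k ((*v) Q ` X)"
    by (rule ball_cover_nonexpansive_image)
      (metis dist_norm matrix_vector_mult_diff_distrib norm_orthogonal_matrix_mult[OF Q] order_refl)
qed

lemma ball_image_decomposition:
  fixes Q P :: "real ^ 'n ^ 'n"
  assumes "orthogonal_matrix P"
  shows "(*v) (Q ** diagonal_matrix a ** transpose P) ` cball 0 1
    = (*v) Q ` (*v) (diagonal_matrix a) ` cball 0 1"
proof -
  have "(*v) (Q ** diagonal_matrix a ** transpose P) ` cball 0 1
      = (*v) Q ` (*v) (diagonal_matrix a) ` (*v) (transpose P) ` cball 0 1"
    by (simp add: image_image matrix_vector_mul_assoc[symmetric] del: transpose_matrix_vector)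
  then show ?thesis
    using assms by (simp only: orthogonal_matrix_image_cball orthogonal_matrix_transpose)
qed

lemma elongation_le_ball_cover:
  fixes A :: "real ^ 'n ^ 'n"
  assumes A: "invertible A" and d: "\<delta> > 0" and cover: "ball_cover \<delta> k ((*v) A ` cball 0 1)"
  shows "elongation A \<delta> \<le> 2 ^ CARD('n) * real k"
proof -
  obtain Q P a where svd: "orthogonal_matrix Q" "orthogonal_matrix P" "\<And>i. a i > 0"
    "A = Q ** diagonal_matrix a ** transpose P"
    using singular_value_decomposition[OF A] by metis
  have "ball_cover \<delta> k ((*v) (diagonal_matrix a) ` cball 0 1)"
    using cover unfolding svd(4) ball_image_decomposition[OF svd(2)]
      ball_cover_orthogonal_image[OF svd(1)] .
  from diagonal_ball_cover_lower[OF this d svd(3)] show ?thesis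
    unfolding elongation_def prod_singular_value[OF svd, of "\<lambda>x. max (x / \<delta>) 1"] .
qed

lemma ball_cover_elongation:
  fixes A :: "real ^ 'n ^ 'n"
  assumes A: "invertible A" and d: "\<delta> > 0"
  obtains k where "ball_cover \<delta> k ((*v) A ` cball 0 1)"
    "real k \<le> (4 * real CARD('n)) ^ CARD('n) * elongation A \<delta>"
proof -
  obtain Q P a where svd: "orthogonal_matrix Q" "orthogonal_matrix P" "\<And>i. a i > 0"
    "A = Q ** diagonal_matrix a ** transpose P"
    using singular_value_decomposition[OF A] by metis
  obtain k where k: "ball_cover \<delta> k ((*v) (diagonal_matrix a) ` cball 0 1)"
    "real k \<le> (4 * real CARD('n)) ^ CARD('n) * (\<Prod>i\<in>UNIV. max (a i / \<delta>) 1)"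
    by (rule diagonal_ball_cover_upper[OF d svd(3)])
  show thesis
  proof (rule that)
    show "ball_cover \<delta> k ((*v) A ` cball 0 1)"
      using k(1) unfolding svd(4) ball_image_decomposition[OF svd(2)]
        ball_cover_orthogonal_image[OF svd(1)] .
    show "real k \<le> (4 * real CARD('n)) ^ CARD('n) * elongation A \<delta>"
      using k(2) unfolding elongation_def prod_singular_value[OF svd, of "\<lambda>x. max (x / \<delta>) 1"] .
  qed
qed

text \<open>This is the form in which the singular value function enters the dimension estimate. The scale is a
  singular value of \<open>A\<close>, hence at most the Lipschitz constant \<open>c\<close>; for long words it is less than 1.\<close>

lemma ball_cover_singular_value_function:
  fixes A :: "real ^ 'n ^ 'n"
  assumes A: "invertible A" and t: "0 \<le> t" "t \<le> real CARD('n)"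
    and c: "\<And>x. norm (A *v x) \<le> c * norm x"
  obtains \<delta> k where "0 < \<delta>" "\<delta> \<le> c" "ball_cover \<delta> k ((*v) A ` cball 0 1)"
    "real k * \<delta> powr t \<le> (4 * real CARD('n)) ^ CARD('n) * singular_value_function t A"
proof -
  obtain m where m: "m \<in> {1..CARD('n)}"
    "singular_value_function t A = singular_value A m powr t * elongation A (singular_value A m)"
    by (rule singular_value_function_eq_elongation[OF A t])
  have pos: "singular_value A m > 0"
    by (rule singular_value_pos[OF A m(1)])
  obtain k where k: "ball_cover (singular_value A m) k ((*v) A ` cball 0 1)"
    "real k \<le> (4 * real CARD('n)) ^ CARD('n) * elongation A (singular_value A m)"
    by (rule ball_cover_elongation[OF A pos])
  show thesis
  proof (rule that[OF pos singular_value_le[OF A c m(1)] k(1)])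
    have "real k * singular_value A m powr t
        \<le> (4 * real CARD('n)) ^ CARD('n) * elongation A (singular_value A m) * singular_value A m powr t"
      using k(2) by (rule mult_right_mono) simp
    then show "real k * singular_value A m powr t
        \<le> (4 * real CARD('n)) ^ CARD('n) * singular_value_function t A"
      by (simp add: m(2) mult_ac)
  qed
qed

text \<open>For \<open>t \<le> n\<close> compose the optimal coverings for \<open>A\<close> and \<open>B\<close>; every covering for \<open>A ** B\<close> bounds its
  singular value function. Beyond \<open>n\<close> the singular value function is a power of the determinant. The
  constant collects the losses \<open>2\<^sup>n\<close> and twice \<open>(4 n)\<^sup>n\<close> of the volume estimates.\<close>

lemma singular_value_function_submultiplicative:
  fixes A B :: "real ^ 'n ^ 'n"
  assumes A: "invertible A" and B: "invertible B" and t: "t \<ge> 0"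
  shows "singular_value_function t (A ** B)
    \<le> (2 * (4 * real CARD('n))\<^sup>2) ^ CARD('n) * (singular_value_function t A * singular_value_function t B)"
    (is "_ \<le> ?K * _")
proof (cases "t \<le> real CARD('n)")
  case True
  let ?n = "CARD('n)"
  let ?L = "(4 * real ?n) ^ ?n"
  have AB: "invertible (A ** B)"
    using A B by (rule invertible_mult)
  obtain cA cB where "\<And>x. norm (A *v x) \<le> cA * norm x" "\<And>x. norm (B *v x) \<le> cB * norm x"
    by (metis bounded_linear.bounded matrix_vector_mul_bounded_linear mult.commute)
  note bounds = this
  obtain \<delta> k where
    d: "0 < \<delta>" "ball_cover \<delta> k ((*v) A ` cball 0 1)"
      "real k * \<delta> powr t \<le> ?L * singular_value_function t A"
    by (rule ball_cover_singular_value_function[OF A t True bounds(1)])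
  obtain \<epsilon> l where
    e: "0 < \<epsilon>" "ball_cover \<epsilon> l ((*v) B ` cball 0 1)"
      "real l * \<epsilon> powr t \<le> ?L * singular_value_function t B"
    by (rule ball_cover_singular_value_function[OF B t True bounds(2)])
  have "(\<lambda>x. A *v x + 0) ` (*v) B ` cball 0 1 = (*v) (A ** B) ` cball 0 1"
    by (simp add: image_image matrix_vector_mul_assoc)
  then have "ball_cover (\<delta> * \<epsilon>) (k * l) ((*v) (A ** B) ` cball 0 1)"
    using ball_cover_affine_image[OF e(2) d(2) e(1), of 0] by simp
  then have "elongation (A ** B) (\<delta> * \<epsilon>) \<le> 2 ^ ?n * real (k * l)"
    using d e by (intro elongation_le_ball_cover[OF AB]) auto
  then have "(\<delta> * \<epsilon>) powr t * elongation (A ** B) (\<delta> * \<epsilon>) \<le> (\<delta> * \<epsilon>) powr t * (2 ^ ?n * real (k * l))"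
    by (rule mult_left_mono) simp
  moreover have "singular_value_function t (A ** B) \<le> (\<delta> * \<epsilon>) powr t * elongation (A ** B) (\<delta> * \<epsilon>)"
    using d e by (intro singular_value_function_le_elongation[OF AB t True]) auto
  ultimately have "singular_value_function t (A ** B) \<le> (\<delta> * \<epsilon>) powr t * (2 ^ ?n * real (k * l))"
    by linarith
  also have "\<dots> = 2 ^ ?n * ((real k * \<delta> powr t) * (real l * \<epsilon> powr t))"
    using d(1) e(1) by (simp add: powr_mult mult_ac)
  also have "\<dots> \<le> 2 ^ ?n * ((?L * singular_value_function t A) * (?L * singular_value_function t B))"
    using d(3) e(3) singular_value_function_pos[OF A t]
    by (intro mult_left_mono[OF mult_mono]) (auto simp: less_imp_le)
  also have "\<dots> = ?K * (singular_value_function t A * singular_value_function t B)"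
    by (simp only: power2_eq_square power_mult_distrib mult_ac)
  finally show ?thesis .
next
  case False
  then have "singular_value_function t (A ** B)
      = singular_value_function t A * singular_value_function t B"
    using t by (simp add: singular_value_function_def det_mul abs_mult powr_mult)
  moreover have "?K \<ge> 1"
  proof (rule one_le_power)
    have "CARD('n) \<ge> 1"
      by (simp add: Suc_leI)
    then have "4 * real CARD('n) \<ge> 1"
      by linarith
    then have "(4 * real CARD('n))\<^sup>2 \<ge> 1"
      by (rule one_le_power)
    then show "2 * (4 * real CARD('n))\<^sup>2 \<ge> 1"
      by simp
  qed
  moreover have "0 \<le> singular_value_function t A * singular_value_function t B"
    using singular_value_function_pos[OF A t] singular_value_function_pos[OF B t] by simp
  ultimately show ?thesis
    using mult_right_mono[of 1 ?K "singular_value_function t A * singular_value_function t B"]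
    by (simp only: mult_1)
qed

section \<open>Pressure sums and the affinity dimension\<close>

lemma word_map_Nil [simp]: "word_map S [] = id"
  by (simp add: word_map_def)

lemma word_map_Cons [simp]: "word_map S (i # w) = S i \<circ> word_map S w"
  by (simp add: word_map_def)

lemma word_map_append: "word_map S (v @ w) = word_map S v \<circ> word_map S w"
  by (induction v) (auto simp: o_assoc)

lemma finite_words [simp]: "finite (words N k)"
  by (simp add: words_def finite_lists_length_eq)

lemma linear_part_affine: "linear_part (\<lambda>x. A *v x + b) = A"
  by (simp add: linear_part_def)

lemma words_Suc: "words N (Suc k) = (\<lambda>(i, w). i # w) ` ({1..N} \<times> words N k)"
  by (auto simp: words_def length_Suc_conv image_iff)

lemma words_add: "words N (k + l) = (\<lambda>(v, w). v @ w) ` (words N k \<times> words N l)"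
proof (intro equalityI subsetI)
  fix u assume "u \<in> words N (k + l)"
  then have "take k u \<in> words N k" "drop k u \<in> words N l" "u = take k u @ drop k u"
    by (auto simp: words_def dest: in_set_takeD in_set_dropD)
  then show "u \<in> (\<lambda>(v, w). v @ w) ` (words N k \<times> words N l)"
    by (metis (mono_tags, lifting) SigmaI case_prod_conv image_eqI)
qed (auto simp: words_def subset_iff)

text \<open>Finitely many contraction ratios have a maximum below 1, so one ratio \<open>c\<close> serves all maps.\<close>

locale contracting_affine_ifs =
  fixes N :: nat and S :: "nat \<Rightarrow> real ^ 'n \<Rightarrow> real ^ 'n" and c :: real
  assumes N: "N \<ge> 1"
    and affine: "\<And>i. i \<in> {1..N} \<Longrightarrow> \<exists>A b. invertible A \<and> S i = (\<lambda>x. A *v x + b)"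
    and c: "0 < c" "c < 1"
    and contracting: "\<And>i x y. i \<in> {1..N} \<Longrightarrow> norm (S i x - S i y) \<le> c * norm (x - y)"

lemma contracting_affine_ifs_exists:
  assumes "affine_ifs N S"
  obtains c where "contracting_affine_ifs N S c"
proof -
  obtain r where r: "\<And>i. i \<in> {1..N} \<Longrightarrow>
      0 < r i \<and> r i < 1 \<and> (\<forall>x y. norm (S i x - S i y) \<le> r i * norm (x - y))"
    using assms unfolding affine_ifs_def by metis
  have ne: "r ` {1..N} \<noteq> {}"
    using assms by (simp add: affine_ifs_def)
  define c where "c = Max (r ` {1..N})"
  have le: "r i \<le> c" if "i \<in> {1..N}" for i
    using that by (simp add: c_def)
  have "c \<in> r ` {1..N}"
    unfolding c_def using ne by (intro Max_in) auto
  then have "0 < c" "c < 1"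
    using r by auto
  moreover have "norm (S i x - S i y) \<le> c * norm (x - y)" if "i \<in> {1..N}" for i x y
    using r[OF that] mult_right_mono[OF le[OF that], of "norm (x - y)"] by (meson norm_ge_zero order_trans)
  ultimately have "contracting_affine_ifs N S c"
    using assms by unfold_locales (auto simp: affine_ifs_def)
  then show thesis by (rule that)
qed

context contracting_affine_ifs
begin

definition word_matrix :: "nat list \<Rightarrow> real ^ 'n ^ 'n" where
  "word_matrix w = linear_part (word_map S w)"

lemma word_map_affine:
  assumes "set w \<subseteq> {1..N}"
  shows "\<exists>A b. invertible A \<and> word_map S w = (\<lambda>x. A *v x + b)"
  using assms
proof (induction w)
  case Nil
  have "invertible (mat 1 :: real ^ 'n ^ 'n)"
    by (simp add: invertible_def)
  then show ?case
    by (intro exI[of _ "mat 1"] exI[of _ 0]) (auto simp: fun_eq_iff)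
next
  case (Cons i w)
  then obtain A b A' b' where *: "invertible A" "word_map S w = (\<lambda>x. A *v x + b)"
    "invertible A'" "S i = (\<lambda>x. A' *v x + b')"
    using affine[of i] by auto
  then have "word_map S (i # w) = (\<lambda>x. (A' ** A) *v x + (A' *v b + b'))"
    by (auto simp: fun_eq_iff matrix_vector_right_distrib matrix_vector_mul_assoc)
  then show ?case
    using invertible_mult[OF *(3,1)] by blast
qed

lemma word_map_eq:
  assumes "set w \<subseteq> {1..N}"
  obtains b where "invertible (word_matrix w)" "word_map S w = (\<lambda>x. word_matrix w *v x + b)"
proof -
  obtain A b where A: "invertible A" "word_map S w = (\<lambda>x. A *v x + b)"
    using word_map_affine[OF assms] by blast
  then have "word_matrix w = A"
    by (simp add: word_matrix_def linear_part_affine)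
  with A show thesis
    using that by simp
qed

lemma invertible_word_matrix: "w \<in> words N k \<Longrightarrow> invertible (word_matrix w)"
  by (rule word_map_eq[of w]) (simp_all add: words_def)

lemma word_matrix_append:
  assumes "v \<in> words N k" "w \<in> words N l"
  shows "word_matrix (v @ w) = word_matrix v ** word_matrix w"
proof -
  have vw: "set v \<subseteq> {1..N}" "set w \<subseteq> {1..N}"
    using assms by (auto simp: words_def)
  obtain a where "word_map S v = (\<lambda>x. word_matrix v *v x + a)"
    by (rule word_map_eq[OF vw(1)])
  moreover obtain b where "word_map S w = (\<lambda>x. word_matrix w *v x + b)"
    by (rule word_map_eq[OF vw(2)])
  ultimately have "word_map S (v @ w) = (\<lambda>x. (word_matrix v ** word_matrix w) *v x + (word_matrix v *v b + a))"
    by (auto simp: fun_eq_iff word_map_append matrix_vector_right_distrib matrix_vector_mul_assoc)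
  then show ?thesis
    by (subst word_matrix_def) (simp add: linear_part_affine)
qed

lemma word_map_contracting:
  assumes "w \<in> words N k"
  shows "norm (word_map S w x - word_map S w y) \<le> c ^ k * norm (x - y)"
  using assms
proof (induction k arbitrary: w)
  case (Suc k)
  then obtain i v where w: "w = i # v" "i \<in> {1..N}" "v \<in> words N k"
    unfolding words_Suc by auto
  have "norm (word_map S w x - word_map S w y) \<le> c * norm (word_map S v x - word_map S v y)"
    using contracting[OF w(2)] by (simp add: w(1))
  also have "\<dots> \<le> c * (c ^ k * norm (x - y))"
    using Suc.IH[OF w(3)] c by (intro mult_left_mono) auto
  finally show ?case by (simp add: mult.assoc)
qed (simp add: words_def)

lemma norm_word_matrix_le:
  assumes "w \<in> words N k"
  shows "norm (word_matrix w *v x) \<le> c ^ k * norm x"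
proof -
  obtain b where "word_map S w = (\<lambda>x. word_matrix w *v x + b)"
    by (rule word_map_eq[of w]) (use assms in \<open>simp add: words_def\<close>)
  then show ?thesis
    using word_map_contracting[OF assms, of x 0] by simp
qed

definition pressure_sum :: "nat \<Rightarrow> real \<Rightarrow> real" where
  "pressure_sum k t = (\<Sum>w\<in>words N k. singular_value_function t (word_matrix w))"

lemma words_nonempty: "words N k \<noteq> {}"
proof -
  have "replicate k 1 \<in> words N k"
    using N by (auto simp: words_def)
  then show ?thesis by blast
qed

lemma pressure_sum_pos: "t \<ge> 0 \<Longrightarrow> pressure_sum k t > 0"
  unfolding pressure_sum_def using words_nonempty invertible_word_matrix
  by (intro sum_pos) (auto intro: singular_value_function_pos)

lemma pressure_sum_0: "pressure_sum k 0 = real N ^ k"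
  by (simp add: pressure_sum_def singular_value_function_def words_def card_lists_length_eq)

lemma continuous_on_pressure_sum: "continuous_on {0..} (pressure_sum k)"
  unfolding pressure_sum_def
  by (intro continuous_on_sum continuous_on_singular_value_function invertible_word_matrix)

lemma pressure_sum_decay:
  assumes "t \<ge> 0" "h \<ge> 0"
  shows "pressure_sum k (t + h) \<le> (c ^ k) powr h * pressure_sum k t"
  unfolding pressure_sum_def sum_distrib_left using assms c
  by (intro sum_mono singular_value_function_decay invertible_word_matrix norm_word_matrix_le) auto

definition distortion :: real where
  "distortion = (2 * (4 * real CARD('n))\<^sup>2) ^ CARD('n)"

lemma distortion_pos: "distortion > 0"
  by (simp add: distortion_def)

lemma pressure_sum_submultiplicative:
  assumes t: "t \<ge> 0"
  shows "pressure_sum (k + l) t \<le> distortion * (pressure_sum k t * pressure_sum l t)"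
proof -
  let ?\<phi> = "\<lambda>w. singular_value_function t (word_matrix w)"
  have inj: "inj_on (\<lambda>(v, w). v @ w) (words N k \<times> words N l)"
    by (auto simp: inj_on_def words_def)
  have "pressure_sum (k + l) t = (\<Sum>(v, w)\<in>words N k \<times> words N l. ?\<phi> (v @ w))"
    unfolding pressure_sum_def words_add by (subst sum.reindex[OF inj]) (simp add: case_prod_unfold)
  also have "\<dots> \<le> (\<Sum>(v, w)\<in>words N k \<times> words N l. distortion * (?\<phi> v * ?\<phi> w))"
  proof (intro sum_mono, clarify)
    fix v w assume vw: "v \<in> words N k" "w \<in> words N l"
    show "?\<phi> (v @ w) \<le> distortion * (?\<phi> v * ?\<phi> w)"
      unfolding word_matrix_append[OF vw] distortion_def
      by (intro singular_value_function_submultiplicative invertible_word_matrix[OF vw(1)]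
          invertible_word_matrix[OF vw(2)] t)
  qed
  also have "\<dots> = distortion * (pressure_sum k t * pressure_sum l t)"
    by (simp only: pressure_sum_def sum_product sum.cartesian_product)
      (simp only: sum_distrib_left case_prod_unfold)
  finally show ?thesis .
qed

lemma pressure_sum_strict_decay:
  assumes "k \<ge> 1" "0 \<le> t" "t < u"
  shows "pressure_sum k u < pressure_sum k t"
proof -
  have "c ^ k > 0" "c ^ k < 1"
    using c assms(1) by (auto intro: power_less_one_iff[THEN iffD2])
  then have "(c ^ k) powr (u - t) < 1"
    using assms(3) powr_less_mono2[of "u - t" "c ^ k" 1] by simp
  then have "(c ^ k) powr (u - t) * pressure_sum k t < pressure_sum k t"
    using pressure_sum_pos[OF assms(2), of k] by simp
  then show ?thesis
    using pressure_sum_decay[of t "u - t" k] assms by simp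
qed

text \<open>The pressure sum is at least 1 at \<open>t = 0\<close> and decays exponentially, so the intermediate value theorem
  applies.\<close>

lemma pressure_sum_root_exists:
  assumes k: "k \<ge> 1"
  shows "\<exists>t\<ge>0. pressure_sum k t = 1"
proof -
  have ck: "c ^ k > 0" "c ^ k < 1"
    using c k by (auto intro: power_less_one_iff[THEN iffD2])
  \<comment> \<open>The exponent for which the decay factor is the reciprocal of the value at 0.\<close>
  define h where "h = ln (real N ^ k) / - ln (c ^ k)"
  have Nk: "real N ^ k \<ge> 1"
    using N by (intro one_le_power) simp
  have h: "h \<ge> 0"
    unfolding h_def using ck Nk by (intro divide_nonneg_pos) (simp_all only: ln_ge_zero ln_less_zero neg_0_less_iff_less)
  have "(c ^ k) powr h = exp (- ln (real N ^ k))"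
    using ck c ln_less_zero[OF ck] by (simp add: powr_def h_def del: ln_realpow ln_powr)
  also have "\<dots> = inverse (real N ^ k)"
    using Nk unfolding exp_minus by (subst exp_ln) linarith+
  finally have "(c ^ k) powr h * real N ^ k = 1"
    using Nk N by simp
  then have "pressure_sum k h \<le> 1"
    using pressure_sum_decay[of 0 h k] h by (simp add: pressure_sum_0)
  moreover have "1 \<le> pressure_sum k 0"
    using Nk by (simp add: pressure_sum_0)
  moreover have "continuous_on {0..h} (pressure_sum k)"
    using continuous_on_pressure_sum by (rule continuous_on_subset) auto
  ultimately show ?thesis
    using IVT2'[of "pressure_sum k" h 1 0] h by auto
qed

lemma affinity_exponent_solves:
  assumes k: "k \<ge> 1"
  shows "affinity_exponent N S k \<ge> 0" "pressure_sum k (affinity_exponent N S k) = 1"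
proof -
  obtain t where t: "t \<ge> 0" "pressure_sum k t = 1"
    using pressure_sum_root_exists[OF k] by blast
  have unique: "u = t" if "u \<ge> 0" "pressure_sum k u = 1" for u
    using pressure_sum_strict_decay[OF k, of t u] pressure_sum_strict_decay[OF k, of u t] t that
    by (cases u t rule: linorder_cases) auto
  have "affinity_exponent N S k = t"
    unfolding affinity_exponent_def word_matrix_def[symmetric] pressure_sum_def[symmetric]
    by (rule the_equality) (use t unique in blast)+
  then show "affinity_exponent N S k \<ge> 0" "pressure_sum k (affinity_exponent N S k) = 1"
    using t by auto
qed

lemma affinity_exponent_less:
  assumes "k \<ge> 1" "t \<ge> 0" "pressure_sum k t < 1"
  shows "affinity_exponent N S k < t"
  using affinity_exponent_solves[OF assms(1)] pressure_sum_strict_decay[OF assms(1,2), of "affinity_exponent N S k"] assms(3)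
  by (cases t "affinity_exponent N S k" rule: linorder_cases) auto

lemma pressure_sum_iterate:
  assumes t: "t \<ge> 0"
  shows "pressure_sum (k * j + r) t \<le> (distortion * pressure_sum k t) ^ j * pressure_sum r t"
proof (induction j)
  case (Suc j)
  have "pressure_sum (k * Suc j + r) t \<le> distortion * (pressure_sum k t * pressure_sum (k * j + r) t)"
    using pressure_sum_submultiplicative[OF t, of k "k * j + r"] by (simp add: add.assoc)
  also have "\<dots> \<le> distortion * (pressure_sum k t * ((distortion * pressure_sum k t) ^ j * pressure_sum r t))"
    using Suc.IH distortion_pos pressure_sum_pos[OF t, of k] by (intro mult_left_mono) auto
  finally show ?case by (simp add: mult_ac)
qed simp

lemma scaled_power_tendsto_0:
  assumes "h > 0"
  shows "(\<lambda>k. K * (c ^ k) powr h) \<longlonglongrightarrow> 0"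
proof -
  have "(\<lambda>k. (c powr h) ^ k) \<longlonglongrightarrow> 0"
    using c assms powr_less_mono2[of h c 1] by (intro LIMSEQ_power_zero) simp
  moreover have "(c ^ k) powr h = (c powr h) ^ k" for k
    using c by (simp add: powr_realpow[symmetric] powr_powr mult.commute)
  ultimately show ?thesis
    using tendsto_mult_right_zero by auto
qed

text \<open>If \<open>k\<close> is so long that the decay gained over \<open>\<epsilon>\<close> beats the constant of submultiplicativity, then the
  pressure sums at \<open>affinity_exponent N S k + \<epsilon>\<close> tend to 0 along all word lengths, which pushes the
  later exponents below that point.\<close>

lemma affinity_exponent_eventually_le:
  assumes e: "\<epsilon> > 0"
  shows "\<forall>\<^sub>F k in sequentially. \<forall>\<^sub>F l in sequentially.
    affinity_exponent N S l \<le> affinity_exponent N S k + \<epsilon>"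
proof -
  have "\<forall>\<^sub>F k in sequentially. distortion * (c ^ k) powr \<epsilon> < 1"
    using scaled_power_tendsto_0[OF e] by (rule order_tendstoD) simp
  moreover have "\<forall>\<^sub>F k in sequentially. k \<ge> (1 :: nat)"
    by (rule eventually_ge_at_top)
  ultimately show ?thesis
  proof eventually_elim
    case (elim k)
    define u where "u = affinity_exponent N S k + \<epsilon>"
    define q where "q = distortion * pressure_sum k u"
    define M where "M = Max ((\<lambda>r. pressure_sum r u) ` {..<k})"
    have s: "affinity_exponent N S k \<ge> 0" "pressure_sum k (affinity_exponent N S k) = 1"
      using affinity_exponent_solves elim(2) by auto
    have u: "u \<ge> 0"
      using s e by (simp add: u_def)
    have "pressure_sum k u \<le> (c ^ k) powr \<epsilon>"
      using pressure_sum_decay[OF s(1), of \<epsilon> k] s(2) e by (simp add: u_def)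
    then have "q \<le> distortion * (c ^ k) powr \<epsilon>"
      unfolding q_def using distortion_pos by simp
    then have q: "0 < q" "q < 1"
      using elim(1) distortion_pos pressure_sum_pos[OF u, of k] by (simp add: q_def, linarith)
    have M: "pressure_sum r u \<le> M" if "r < k" for r
      using that by (simp add: M_def)
    have M_pos: "M > 0"
      using M[of 0] pressure_sum_pos[OF u, of 0] elim(2) by simp
    have "(\<lambda>j. q ^ j * M) \<longlonglongrightarrow> 0"
      using q by (intro tendsto_mult_left_zero LIMSEQ_power_zero) auto
    then have "\<forall>\<^sub>F j in sequentially. q ^ j * M < 1"
      by (rule order_tendstoD) simp
    then obtain j0 where j0: "\<And>j. j \<ge> j0 \<Longrightarrow> q ^ j * M < 1"
      by (auto simp: eventually_sequentially)
    have "affinity_exponent N S l \<le> u" if l: "l \<ge> k * j0 + 1" for l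
    proof -
      have "j0 = (k * j0) div k"
        using elim(2) by simp
      also have "\<dots> \<le> l div k"
        using l by (intro div_le_mono) simp
      finally have "j0 \<le> l div k" .
      have "pressure_sum l u \<le> q ^ (l div k) * pressure_sum (l mod k) u"
        using pressure_sum_iterate[OF u, of k "l div k" "l mod k"] by (simp add: q_def)
      also have "\<dots> \<le> q ^ (l div k) * M"
        using q M[of "l mod k"] elim(2) by (intro mult_left_mono) auto
      also have "\<dots> < 1"
        using j0 \<open>j0 \<le> l div k\<close> by blast
      finally show ?thesis
        using affinity_exponent_less[of l u] l u by simp
    qed
    then show ?case
      unfolding u_def eventually_sequentially by blast
  qed
qed

end

text \<open>The hypothesis says that the limit superior is at most the limit inferior plus \<open>\<epsilon>\<close>. The limit is the
  infimum of the eventual upper bounds.\<close>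

lemma convergent_if_eventually_le:
  fixes s :: "nat \<Rightarrow> real"
  assumes bdd: "\<forall>\<^sub>F k in sequentially. B \<le> s k"
    and le: "\<And>\<epsilon>. \<epsilon> > 0 \<Longrightarrow> \<forall>\<^sub>F k in sequentially. \<forall>\<^sub>F l in sequentially. s l \<le> s k + \<epsilon>"
  shows "convergent s"
proof -
  define Y where "Y = {y. \<forall>\<^sub>F l in sequentially. s l \<le> y}"
  have lower: "B \<le> y" if "y \<in> Y" for y
  proof -
    have "\<forall>\<^sub>F l in sequentially. B \<le> s l \<and> s l \<le> y"
      using bdd that by (auto simp: Y_def intro: eventually_conj)
    then show ?thesis
      by (auto simp: eventually_sequentially)
  qed
  have "\<exists>k. \<forall>\<^sub>F l in sequentially. s l \<le> s k + 1"
    using eventually_happens'[OF sequentially_bot le[of 1]] by simp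
  then have ne: "Y \<noteq> {}"
    by (auto simp: Y_def)
  have bb: "bdd_below Y"
    using lower by (rule bdd_belowI)
  have "s \<longlonglongrightarrow> Inf Y"
  proof (rule tendstoI)
    fix e :: real assume e: "e > 0"
    obtain y where y: "y \<in> Y" "y < Inf Y + e"
      using cInf_less_iff[OF ne bb, of "Inf Y + e"] e by auto
    have "\<forall>\<^sub>F l in sequentially. s l \<le> y"
      using y(1) by (simp add: Y_def)
    moreover have "\<forall>\<^sub>F k in sequentially. \<forall>\<^sub>F l in sequentially. s l \<le> s k + e / 2"
      using le e by simp
    ultimately show "\<forall>\<^sub>F k in sequentially. dist (s k) (Inf Y) < e"
    proof eventually_elim
      case (elim k)
      then have "s k + e / 2 \<in> Y"
        by (simp add: Y_def)
      then have "Inf Y \<le> s k + e / 2"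
        using bb by (rule cInf_lower)
      then show ?case
        using elim(1) y(2) e by (simp add: dist_real_def abs_less_iff)
    qed
  qed
  then show ?thesis
    by (rule convergentI)
qed

context contracting_affine_ifs
begin

lemma affinity_exponent_tendsto: "affinity_exponent N S \<longlonglongrightarrow> affinity_dimension N S"
proof -
  have "\<forall>\<^sub>F k in sequentially. 0 \<le> affinity_exponent N S k"
    using affinity_exponent_solves(1) eventually_sequentially by blast
  then have "convergent (affinity_exponent N S)"
    using affinity_exponent_eventually_le by (rule convergent_if_eventually_le)
  then show ?thesis
    unfolding affinity_dimension_def by (simp add: convergent_LIMSEQ_iff)
qed

lemma affinity_dimension_nonneg: "affinity_dimension N S \<ge> 0"
  by (rule LIMSEQ_le_const[OF affinity_exponent_tendsto]) (use affinity_exponent_solves(1) in blast)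

text \<open>Between \<open>s\<close> and \<open>t\<close> there is room for exponential decay in \<open>k\<close>, which absorbs any constant \<open>K\<close>.\<close>

lemma pressure_sum_small:
  assumes t: "affinity_dimension N S < t"
  obtains k where "k \<ge> 1" "K * pressure_sum k t < 1"
proof -
  define u where "u = (affinity_dimension N S + t) / 2"
  have u: "affinity_dimension N S < u" "u < t" "0 \<le> u"
    using t affinity_dimension_nonneg by (auto simp: u_def)
  have "\<forall>\<^sub>F k in sequentially. affinity_exponent N S k < u"
    using affinity_exponent_tendsto u(1) by (rule order_tendstoD)
  moreover have "\<forall>\<^sub>F k in sequentially. \<bar>K\<bar> * (c ^ k) powr (t - u) < 1"
    using scaled_power_tendsto_0[of "t - u" "\<bar>K\<bar>"] u(2) by (intro order_tendstoD) auto
  moreover have "\<forall>\<^sub>F k in sequentially. k \<ge> (1 :: nat)"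
    by (rule eventually_ge_at_top)
  ultimately have "\<forall>\<^sub>F k in sequentially. k \<ge> 1 \<and> K * pressure_sum k t < 1"
  proof eventually_elim
    case (elim k)
    have "pressure_sum k u \<le> 1"
      using pressure_sum_strict_decay[OF elim(3) affinity_exponent_solves(1)[OF elim(3)] elim(1)]
        affinity_exponent_solves(2)[OF elim(3)] by simp
    then have "(c ^ k) powr (t - u) * pressure_sum k u \<le> (c ^ k) powr (t - u) * 1"
      by (intro mult_left_mono) auto
    then have "pressure_sum k t \<le> (c ^ k) powr (t - u)"
      using pressure_sum_decay[OF u(3), of "t - u" k] u(2) by simp
    then have "\<bar>K\<bar> * pressure_sum k t \<le> \<bar>K\<bar> * (c ^ k) powr (t - u)"
      by (intro mult_left_mono) auto
    moreover have "K * pressure_sum k t \<le> \<bar>K\<bar> * pressure_sum k t"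
      using pressure_sum_pos[of t k] u by (intro mult_right_mono) auto
    ultimately show ?case
      using elim by linarith
  qed
  then show thesis
    using that by (auto simp: eventually_sequentially)
qed

end

section \<open>Box dimension and covering growth\<close>

text \<open>For a bounded set this is, up to an arbitrarily small change of \<open>t\<close>, the condition that the upper box
  dimension is at most \<open>t\<close>. Asking for it at all scales up to 1, with a constant, is what the induction
  over scales needs.\<close>

definition covering_growth :: "real \<Rightarrow> 'a::metric_space set \<Rightarrow> bool" where
  "covering_growth t X \<longleftrightarrow>
     (\<exists>K\<ge>0. \<forall>r. 0 < r \<and> r \<le> 1 \<longrightarrow> (\<exists>m. ball_cover r m X \<and> real m \<le> K * r powr - t))"

lemma covering_growth_UN:
  assumes "finite I" "\<And>i. i \<in> I \<Longrightarrow> covering_growth t (X i)"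
  shows "covering_growth t (\<Union>i\<in>I. X i)"
proof -
  have "\<exists>K. \<forall>i\<in>I. K i \<ge> 0 \<and>
      (\<forall>r. 0 < r \<and> r \<le> 1 \<longrightarrow> (\<exists>m. ball_cover r m (X i) \<and> real m \<le> K i * r powr - t))"
    by (rule bchoice) (use assms(2) in \<open>simp add: covering_growth_def\<close>)
  then obtain K where K: "\<And>i. i \<in> I \<Longrightarrow> K i \<ge> 0"
    "\<And>i r. i \<in> I \<Longrightarrow> 0 < r \<Longrightarrow> r \<le> 1 \<Longrightarrow> \<exists>m. ball_cover r m (X i) \<and> real m \<le> K i * r powr - t"
    by blast
  have "\<exists>m. ball_cover r m (\<Union>i\<in>I. X i) \<and> real m \<le> (\<Sum>i\<in>I. K i) * r powr - t"
    if r: "0 < r" "r \<le> 1" for r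
  proof -
    have "\<exists>m. \<forall>i\<in>I. ball_cover r (m i) (X i) \<and> real (m i) \<le> K i * r powr - t"
      by (rule bchoice) (use K(2) r in blast)
    then obtain m where m: "\<And>i. i \<in> I \<Longrightarrow> ball_cover r (m i) (X i)"
      "\<And>i. i \<in> I \<Longrightarrow> real (m i) \<le> K i * r powr - t"
      by blast
    have "ball_cover r (\<Sum>i\<in>I. m i) (\<Union>i\<in>I. X i)"
      using assms(1) m(1) by (rule ball_cover_UN)
    moreover have "real (\<Sum>i\<in>I. m i) \<le> (\<Sum>i\<in>I. K i) * r powr - t"
      unfolding of_nat_sum sum_distrib_right by (rule sum_mono) (rule m(2))
    ultimately show ?thesis by blast
  qed
  then show ?thesis
    unfolding covering_growth_def using K(1) by (intro exI[of _ "\<Sum>i\<in>I. K i"]) (auto intro: sum_nonneg)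
qed

lemma covering_growth_nonexpansive_image:
  assumes "covering_growth t X" "\<And>x y. dist (f x) (f y) \<le> dist x y"
  shows "covering_growth t (f ` X)"
  using assms(1) unfolding covering_growth_def
  by (meson ball_cover_nonexpansive_image[OF _ assms(2)])

text \<open>A large ball is the image of the unit ball under a multiple of the identity, whose elongation at
  scale \<open>r\<close> is of order \<open>r powr - n\<close>.\<close>

lemma covering_growth_bounded:
  fixes F :: "(real ^ 'n) set"
  assumes "bounded F"
  shows "covering_growth (real CARD('n)) F"
proof -
  obtain R0 where R0: "\<And>x. x \<in> F \<Longrightarrow> norm x \<le> R0"
    using assms unfolding bounded_iff by blast
  define R where "R = max 1 R0"
  have R: "R \<ge> 1" "F \<subseteq> cball 0 R"
    using R0 by (force simp: R_def)+
  let ?A = "diagonal_matrix (\<lambda>_. R) :: real ^ 'n ^ 'n"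
  let ?n = "CARD('n)"
  have mult: "?A *v x = R *\<^sub>R x" for x
    by (simp add: vec_eq_iff diagonal_matrix_mult_vector)
  have A: "invertible ?A"
    using R(1) by (simp add: invertible_det_nz det_diagonal_matrix)
  have img: "(*v) ?A ` cball 0 1 = cball 0 R"
    using R(1) cball_scale[of R 0 1] by (simp add: mult image_def)
  have "\<exists>m. ball_cover r m F \<and> real m \<le> ((4 * real ?n) ^ ?n * R ^ ?n) * r powr - real ?n"
    if r: "0 < r" "r \<le> 1" for r
  proof -
    obtain k where k: "ball_cover r k ((*v) ?A ` cball 0 1)"
      "real k \<le> (4 * real ?n) ^ ?n * elongation ?A r"
      by (rule ball_cover_elongation[OF A r(1)])
    have "elongation ?A r \<le> (\<Prod>j = 1..?n. R / r)"
      unfolding elongation_def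
    proof (intro prod_mono conjI)
      fix j assume j: "j \<in> {1..?n}"
      have "singular_value ?A j \<le> R"
        using R(1) by (intro singular_value_le[OF A _ j]) (simp add: mult)
      then show "max (singular_value ?A j / r) 1 \<le> R / r"
        using R(1) r by (simp add: divide_right_mono)
    qed auto
    also have "\<dots> = R ^ ?n * r powr - real ?n"
      using r by (simp add: powr_minus powr_realpow divide_inverse power_mult_distrib power_inverse)
    finally have "real k \<le> (4 * real ?n) ^ ?n * (R ^ ?n * r powr - real ?n)"
      by (intro order_trans[OF k(2)] mult_left_mono) simp_all
    moreover have "ball_cover r k F"
      using ball_cover_mono[OF k(1)[unfolded img] order_refl order_refl R(2)] .
    ultimately show ?thesis
      by (auto simp: mult.assoc)
  qed
  moreover have "(4 * real ?n) ^ ?n * R ^ ?n \<ge> 0"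
    using R(1) by simp
  ultimately show ?thesis
    unfolding covering_growth_def by blast
qed

lemma ball_cover_bounded:
  fixes F :: "(real ^ 'n) set"
  assumes "bounded F" "r > 0"
  obtains m where "ball_cover r m F"
proof -
  obtain K where "\<And>r. 0 < r \<Longrightarrow> r \<le> 1 \<Longrightarrow> \<exists>m. ball_cover r m F \<and> real m \<le> K * r powr - real CARD('n)"
    using covering_growth_bounded[OF assms(1)] unfolding covering_growth_def by blast
  then obtain m where "ball_cover (min r 1) m F"
    using assms(2) by (metis min.cobounded2 min_less_iff_conj zero_less_one)
  then show thesis
    using that ball_cover_mono[of "min r 1" m F r m F] by simp
qed

lemma cball_subset_hypercube:
  fixes p :: "real ^ 'n"
  obtains Q where "hypercube \<delta> Q" "cball p (\<delta> / 2) \<subseteq> Q"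
proof
  let ?a = "p - (\<chi> i. \<delta> / 2)"
  show "hypercube \<delta> ((\<lambda>x. ?a + x) ` cbox 0 (\<chi> i. \<delta>))"
    unfolding hypercube_def using orthogonal_transformation_id
    by (intro exI[of _ id] exI[of _ ?a]) (simp add: id_def)
  show "cball p (\<delta> / 2) \<subseteq> (\<lambda>x. ?a + x) ` cbox 0 (\<chi> i. \<delta>)"
  proof
    fix x assume x: "x \<in> cball p (\<delta> / 2)"
    have "x - ?a \<in> cbox 0 (\<chi> i. \<delta>)"
      unfolding mem_box_cart
    proof
      fix i
      have "\<bar>x $ i - p $ i\<bar> \<le> \<delta> / 2"
        using component_le_norm_cart[of "x - p" i] x by (simp add: dist_norm norm_minus_commute)
      then show "0 $ i \<le> (x - ?a) $ i \<and> (x - ?a) $ i \<le> (\<chi> i. \<delta>) $ i"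
        by (simp only: vector_minus_component vec_lambda_beta zero_index) linarith
    qed
    then show "x \<in> (\<lambda>x. ?a + x) ` cbox 0 (\<chi> i. \<delta>)"
      by (intro image_eqI[of _ _ "x - ?a"]) auto
  qed
qed

lemma hypercube_subset_cball:
  assumes "hypercube \<delta> (Q :: (real ^ 'n) set)"
  obtains p where "Q \<subseteq> cball p (real CARD('n) * \<delta>)"
proof -
  obtain R :: "real ^ 'n \<Rightarrow> real ^ 'n" and a where R: "orthogonal_transformation R" "Q = (\<lambda>x. a + R x) ` cbox 0 (\<chi> i. \<delta>)"
    using assms unfolding hypercube_def by blast
  have "norm (R x) \<le> real CARD('n) * \<delta>" if "x \<in> cbox 0 (\<chi> i. \<delta>)" for x
  proof -
    have "norm (R x) = norm x"
      using R(1) by (rule orthogonal_transformation_norm)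
    also have "\<dots> \<le> (\<Sum>i\<in>UNIV. \<bar>x $ i\<bar>)"
      by (rule norm_le_l1_cart)
    also have "\<dots> \<le> (\<Sum>i\<in>(UNIV :: 'n set). \<delta>)"
      using that by (intro sum_mono) (auto simp: mem_box_cart)
    finally show ?thesis by simp
  qed
  then have "Q \<subseteq> cball a (real CARD('n) * \<delta>)"
    by (auto simp: R(2) dist_norm)
  then show thesis by (rule that)
qed

lemma hypercube_cover_exists:
  assumes "ball_cover (\<delta> / 2) m (F :: (real ^ 'n) set)"
  obtains \<Q> where "finite \<Q>" "card \<Q> \<le> m" "\<forall>Q\<in>\<Q>. hypercube \<delta> Q" "F \<subseteq> \<Union>\<Q>"
proof -
  obtain P where P: "finite P" "card P \<le> m" "F \<subseteq> (\<Union>p\<in>P. cball p (\<delta> / 2))"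
    using assms unfolding ball_cover_def by blast
  have "\<forall>p. \<exists>Q. hypercube \<delta> Q \<and> cball (p :: real ^ 'n) (\<delta> / 2) \<subseteq> Q"
    using cball_subset_hypercube by metis
  then obtain Q where Q: "\<And>p. hypercube \<delta> (Q p)" "\<And>p :: real ^ 'n. cball p (\<delta> / 2) \<subseteq> Q p"
    by metis
  have "F \<subseteq> \<Union>(Q ` P)"
    using P(3) Q(2) by blast
  then show thesis
    using P(1) Q(1) order_trans[OF card_image_le[OF P(1), of Q] P(2)] by (intro that[of "Q ` P"]) auto
qed

lemma covering_number_le:
  assumes "ball_cover (\<delta> / 2) m (F :: (real ^ 'n) set)"
  shows "covering_number \<delta> F \<le> m"
proof -
  obtain \<Q> where Q: "finite \<Q>" "card \<Q> \<le> m" "\<forall>Q\<in>\<Q>. hypercube \<delta> Q" "F \<subseteq> \<Union>\<Q>"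
    by (rule hypercube_cover_exists[OF assms])
  then have "covering_number \<delta> F \<le> card \<Q>"
    unfolding covering_number_def by (intro Least_le) blast
  with Q(2) show ?thesis by simp
qed

lemma covering_number_attained:
  fixes F :: "(real ^ 'n) set"
  assumes "bounded F" "\<delta> > 0"
  obtains \<Q> where "finite \<Q>" "card \<Q> = covering_number \<delta> F" "\<forall>Q\<in>\<Q>. hypercube \<delta> Q" "F \<subseteq> \<Union>\<Q>"
proof -
  obtain m where m: "ball_cover (\<delta> / 2) m F"
    using ball_cover_bounded[OF assms(1), of "\<delta> / 2"] assms(2) by auto
  have "\<exists>k \<Q>. finite \<Q> \<and> card \<Q> = k \<and> (\<forall>Q\<in>\<Q>. hypercube \<delta> Q) \<and> F \<subseteq> \<Union>\<Q>"
    by (rule hypercube_cover_exists[OF m]) blast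
  then have "\<exists>\<Q>. finite \<Q> \<and> card \<Q> = covering_number \<delta> F \<and> (\<forall>Q\<in>\<Q>. hypercube \<delta> Q) \<and> F \<subseteq> \<Union>\<Q>"
    unfolding covering_number_def by (rule LeastI_ex)
  then show thesis
    using that by blast
qed

lemma ball_cover_covering_number:
  fixes F :: "(real ^ 'n) set"
  assumes "bounded F" "\<delta> > 0"
  shows "ball_cover (real CARD('n) * \<delta>) (covering_number \<delta> F) F"
proof -
  obtain \<Q> where Q: "finite \<Q>" "card \<Q> = covering_number \<delta> F" "\<forall>Q\<in>\<Q>. hypercube \<delta> Q" "F \<subseteq> \<Union>\<Q>"
    by (rule covering_number_attained[OF assms])
  have "\<exists>p. \<forall>Q\<in>\<Q>. Q \<subseteq> cball (p Q) (real CARD('n) * \<delta>)"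
    by (rule bchoice) (use Q(3) hypercube_subset_cball in blast)
  then obtain p where p: "\<And>Q. Q \<in> \<Q> \<Longrightarrow> Q \<subseteq> cball (p Q) (real CARD('n) * \<delta>)"
    by blast
  have "F \<subseteq> (\<Union>q\<in>p ` \<Q>. cball q (real CARD('n) * \<delta>))"
    using Q(4) p by blast
  then show ?thesis
    unfolding ball_cover_def using Q(1,2) card_image_le[OF Q(1), of p] by (intro exI[of _ "p ` \<Q>"]) auto
qed

lemma covering_number_mono:
  assumes "bounded G" "F \<subseteq> G" "\<delta> > 0"
  shows "covering_number \<delta> F \<le> covering_number \<delta> (G :: (real ^ 'n) set)"
proof -
  obtain \<Q> where "finite \<Q>" "card \<Q> = covering_number \<delta> G" "\<forall>Q\<in>\<Q>. hypercube \<delta> Q" "G \<subseteq> \<Union>\<Q>"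
    by (rule covering_number_attained[OF assms(1,3)])
  then have "\<exists>\<Q>. finite \<Q> \<and> card \<Q> = covering_number \<delta> G \<and> (\<forall>Q\<in>\<Q>. hypercube \<delta> Q) \<and> F \<subseteq> \<Union>\<Q>"
    using assms(2) by blast
  then show ?thesis
    by (subst covering_number_def) (rule Least_le)
qed

lemma ln_of_nat_le:
  assumes "real m \<le> x" "x \<ge> 1"
  shows "ln (real m) \<le> ln x"
  using assms by (cases "m = 0") auto

lemma upper_box_dim_mono:
  assumes "bounded G" "F \<subseteq> G"
  shows "upper_box_dim F \<le> upper_box_dim (G :: (real ^ 'n) set)"
  unfolding upper_box_dim_def
proof (rule Limsup_mono)
  have "\<forall>\<^sub>F \<delta>::real in at_right 0. \<delta> > 0" "\<forall>\<^sub>F \<delta>::real in at_right 0. \<delta> < 1"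
    by (auto intro: eventually_at_right_less eventually_at_rightI[of 0 1])
  then show "\<forall>\<^sub>F \<delta> in at_right 0. ereal (ln (real (covering_number \<delta> F)) / - ln \<delta>)
      \<le> ereal (ln (real (covering_number \<delta> G)) / - ln \<delta>)"
  proof eventually_elim
    case (elim \<delta>)
    have le: "covering_number \<delta> F \<le> covering_number \<delta> G"
      using covering_number_mono[OF assms elim(1)] .
    have "ln (real (covering_number \<delta> F)) \<le> ln (real (covering_number \<delta> G))"
    proof (cases "covering_number \<delta> F = 0")
      case True
      then show ?thesis
        by (cases "covering_number \<delta> G = 0") auto
    next
      case False
      then show ?thesis using le by simp
    qed
    then show ?case
      using elim by (simp add: divide_right_mono_neg)
  qed
qed

lemma upper_box_dim_le_covering_growth:
  assumes growth: "covering_growth t F" and t: "t \<ge> 0"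
  shows "upper_box_dim (F :: (real ^ 'n) set) \<le> ereal t"
proof -
  obtain K where K: "K \<ge> 0"
    "\<And>r. 0 < r \<Longrightarrow> r \<le> 1 \<Longrightarrow> \<exists>m. ball_cover r m F \<and> real m \<le> K * r powr - t"
    using growth unfolding covering_growth_def by blast
  define L where "L = max 1 (K * 2 powr t)"
  have L: "L \<ge> 1"
    by (simp add: L_def)
  have "\<forall>\<^sub>F \<delta>::real in at_right 0. \<delta> > 0" "\<forall>\<^sub>F \<delta>::real in at_right 0. \<delta> < 1"
    by (auto intro: eventually_at_right_less eventually_at_rightI[of 0 1])
  then have "\<forall>\<^sub>F \<delta> in at_right 0. ereal (ln (real (covering_number \<delta> F)) / - ln \<delta>)
      \<le> ereal (ln L / - ln \<delta> + t)"
  proof eventually_elim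
    case (elim \<delta>)
    obtain m where m: "ball_cover (\<delta> / 2) m F" "real m \<le> K * (\<delta> / 2) powr - t"
      using K(2)[of "\<delta> / 2"] elim by auto
    have "real (covering_number \<delta> F) \<le> real m"
      using covering_number_le[OF m(1)] by simp
    also have "\<dots> \<le> (K * 2 powr t) * \<delta> powr - t"
      using m(2) elim by (simp add: powr_divide powr_minus divide_simps)
    also have "\<dots> \<le> L * \<delta> powr - t"
      by (intro mult_right_mono) (auto simp: L_def)
    finally have "real (covering_number \<delta> F) \<le> L * \<delta> powr - t" .
    moreover have "1 \<le> L * \<delta> powr - t"
    proof -
      have "1 * 1 \<le> L * \<delta> powr - t"
        using L elim t powr_mono'[of "- t" 0 \<delta>] by (intro mult_mono) auto
      then show ?thesis by simp
    qed
    ultimately have "ln (real (covering_number \<delta> F)) \<le> ln (L * \<delta> powr - t)"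
      by (rule ln_of_nat_le)
    also have "\<dots> = ln L + t * - ln \<delta>"
      using L elim by (simp add: ln_mult ln_powr)
    finally have "ln (real (covering_number \<delta> F)) / - ln \<delta> \<le> (ln L + t * - ln \<delta>) / - ln \<delta>"
      using elim by (intro divide_right_mono) auto
    also have "\<dots> = ln L / - ln \<delta> + t"
      using elim ln_less_zero[of \<delta>] by (simp add: field_simps)
    finally show ?case by simp
  qed
  then have "upper_box_dim F \<le> Limsup (at_right 0) (\<lambda>\<delta>. ereal (ln L / - ln \<delta> + t))"
    unfolding upper_box_dim_def by (rule Limsup_mono)
  also have "\<dots> = ereal t"
  proof (rule lim_imp_Limsup)
    have "((\<lambda>\<delta>::real. ln L / - ln \<delta> + t) \<longlongrightarrow> 0 + t) (at_right 0)"
      by (intro tendsto_add tendsto_const tendsto_divide_0[OF tendsto_const]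
          filterlim_at_top_imp_at_infinity filterlim_uminus_at_bot[THEN iffD1] ln_at_0)
    then show "((\<lambda>\<delta>. ereal (ln L / - ln \<delta> + t)) \<longlongrightarrow> ereal t) (at_right 0)"
      by simp
  qed simp
  finally show ?thesis .
qed

lemma covering_growth_upper_box_dim:
  fixes F :: "(real ^ 'n) set"
  assumes F: "bounded F" and dim: "upper_box_dim F < ereal t"
  shows "covering_growth t F"
proof -
  have "\<forall>\<^sub>F \<delta> in at_right 0. ereal (ln (real (covering_number \<delta> F)) / - ln \<delta>) < ereal t"
    using dim unfolding upper_box_dim_def by (rule Limsup_lessD)
  then obtain d0 where d0: "d0 > 0"
    "\<And>\<delta>. 0 < \<delta> \<Longrightarrow> \<delta> < d0 \<Longrightarrow> ln (real (covering_number \<delta> F)) / - ln \<delta> < t"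
    by (auto simp: eventually_at_right_field)
  let ?n = "real CARD('n)"
  \<comment> \<open>Cubes of side \<open>\<kappa> * r\<close> lie in balls of radius \<open>r\<close>, and for \<open>r \<le> 1\<close> their side is below the threshold \<open>d0\<close>.\<close>
  define \<kappa> where "\<kappa> = min (1 / (2 * ?n)) (d0 / 2)"
  have n: "?n \<ge> 1"
    by (simp add: Suc_leI)
  have \<kappa>: "0 < \<kappa>" "\<kappa> < d0" "?n * \<kappa> \<le> 1" "\<kappa> < 1"
  proof -
    show "0 < \<kappa>" "\<kappa> < d0"
      using n d0(1) by (auto simp: \<kappa>_def)
    have "\<kappa> \<le> 1 / (2 * ?n)"
      by (simp add: \<kappa>_def)
    then have "2 * (?n * \<kappa>) \<le> 1"
      using n by (simp add: field_simps)
    moreover have "?n * \<kappa> \<ge> \<kappa>"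
      using n \<open>0 < \<kappa>\<close> by simp
    ultimately show "?n * \<kappa> \<le> 1" "\<kappa> < 1"
      using \<open>0 < \<kappa>\<close> by linarith+
  qed
  have "\<exists>m. ball_cover r m F \<and> real m \<le> \<kappa> powr - t * r powr - t" if r: "0 < r" "r \<le> 1" for r
  proof -
    define \<delta> where "\<delta> = \<kappa> * r"
    have "\<delta> \<le> \<kappa>"
      using r \<kappa> by (simp add: \<delta>_def mult_left_le)
    moreover have "0 < \<delta>"
      using r \<kappa> by (simp add: \<delta>_def)
    ultimately have \<delta>: "0 < \<delta>" "\<delta> < d0" "\<delta> < 1"
      using \<kappa> by linarith+
    have "?n * \<delta> \<le> r"
      using mult_right_mono[OF \<kappa>(3), of r] r by (simp add: \<delta>_def mult.assoc)
    then have cover: "ball_cover r (covering_number \<delta> F) F"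
      by (intro ball_cover_mono[OF ball_cover_covering_number[OF F \<delta>(1)]] order_refl)
    have "real (covering_number \<delta> F) \<le> \<delta> powr - t"
    proof (cases "covering_number \<delta> F = 0")
      case False
      have "ln (real (covering_number \<delta> F)) < t * - ln \<delta>"
        using d0(2)[OF \<delta>(1,2)] ln_less_zero[OF \<delta>(1,3)] by (subst (asm) pos_divide_less_eq) auto
      then have "exp (ln (real (covering_number \<delta> F))) < exp (t * - ln \<delta>)"
        by (rule exp_less_mono)
      then show ?thesis
        using False \<delta>(1) by (simp add: powr_def)
    qed simp
    also have "\<dots> = \<kappa> powr - t * r powr - t"
      using \<kappa> r by (simp add: \<delta>_def powr_mult)
    finally show ?thesis
      using cover by blast
  qed
  then show ?thesis
    unfolding covering_growth_def by (intro exI[of _ "\<kappa> powr - t"]) auto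
qed

section \<open>The renewal inequality\<close>

text \<open>Suppose that a covering of \<open>F\<close> at scale \<open>r\<close> can be assembled from \<open>M w\<close> copies of coverings at the
  larger scales \<open>r / \<delta> w\<close> and one covering of \<open>X\<close>. If the bound \<open>L r powr - t\<close> holds at the larger scales,
  the assembled covering has at most \<open>(q L + K) r powr - t\<close> balls, where \<open>q < 1\<close> is the sum of
  \<open>M w * \<delta> w powr t\<close>; any \<open>L \<ge> K / (1 - q)\<close> therefore reproduces itself. Passing from \<open>r\<close> to \<open>r / \<delta> w\<close>
  gains at least the factor \<open>1 / \<theta>\<close>, so finitely many steps lead from any scale to the scales above
  the least \<open>\<delta> w\<close>, where one fixed covering serves.\<close>

lemma covering_growth_renewal:
  fixes F :: "'a::metric_space set" and \<delta> :: "'i \<Rightarrow> real" and M :: "'i \<Rightarrow> nat"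
  assumes J: "finite J" "J \<noteq> {}" and \<delta>: "\<And>w. w \<in> J \<Longrightarrow> 0 < \<delta> w" "\<And>w. w \<in> J \<Longrightarrow> \<delta> w \<le> \<theta>"
    and \<theta>: "\<theta> < 1" and sum_less: "(\<Sum>w\<in>J. real (M w) * \<delta> w powr t) < 1" and t: "t \<ge> 0"
    and step: "\<And>r k m. 0 < r \<Longrightarrow> (\<And>w. w \<in> J \<Longrightarrow> ball_cover (r / \<delta> w) (k w) F) \<Longrightarrow> ball_cover r m X
        \<Longrightarrow> ball_cover r ((\<Sum>w\<in>J. M w * k w) + m) F"
    and X: "covering_growth t X"
    and F: "\<And>r. r > 0 \<Longrightarrow> \<exists>m. ball_cover r m F"
  shows "covering_growth t F"
proof -
  obtain K where K: "K \<ge> 0"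
    "\<And>r. 0 < r \<Longrightarrow> r \<le> 1 \<Longrightarrow> \<exists>m. ball_cover r m X \<and> real m \<le> K * r powr - t"
    using X unfolding covering_growth_def by blast
  define q where "q = (\<Sum>w\<in>J. real (M w) * \<delta> w powr t)"
  define \<delta>\<^sub>0 where "\<delta>\<^sub>0 = Min (\<delta> ` J)"
  have \<delta>0_le: "\<delta>\<^sub>0 \<le> \<delta> w" if "w \<in> J" for w
    using that J(1) by (simp add: \<delta>\<^sub>0_def)
  have \<delta>0: "\<delta>\<^sub>0 > 0"
    using J \<delta>(1) by (simp add: \<delta>\<^sub>0_def)
  have \<theta>0: "\<theta> > 0"
    using J(2) \<delta> by (metis all_not_in_conv less_le_trans)
  obtain m0 where m0: "ball_cover \<delta>\<^sub>0 m0 F"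
    using F[OF \<delta>0] by blast
  define L where "L = max (real m0) (K / (1 - q))"
  have L: "L \<ge> 0" "real m0 \<le> L" "q * L + K \<le> L"
  proof -
    show "L \<ge> 0" "real m0 \<le> L"
      by (auto simp: L_def le_max_iff_disj)
    have "K / (1 - q) \<le> L"
      by (simp add: L_def)
    then show "q * L + K \<le> L"
      using sum_less by (simp add: q_def[symmetric] field_simps)
  qed
  have main: "\<exists>m. ball_cover r m F \<and> real m \<le> L * r powr - t"
    if "\<delta>\<^sub>0 * \<theta> ^ p \<le> r" "r \<le> 1" for p r
    using that
  proof (induction p arbitrary: r)
    case 0
    then have r: "\<delta>\<^sub>0 \<le> r" "r \<le> 1" by auto
    have "ball_cover r m0 F"
      using m0 r(1) by (rule ball_cover_mono) auto
    moreover have "1 \<le> r powr - t"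
      using powr_mono'[of "- t" 0 r] r \<delta>0 t by simp
    then have "real m0 * 1 \<le> L * r powr - t"
      using L by (intro mult_mono) auto
    ultimately show ?case by auto
  next
    case (Suc p)
    show ?case
    proof (cases "\<delta>\<^sub>0 * \<theta> ^ p \<le> r")
      case True
      then show ?thesis
        using Suc.IH Suc.prems(2) by blast
    next
      case False
      then have small: "r < \<delta>\<^sub>0 * \<theta> ^ p" by simp
      have r: "r > 0"
        using Suc.prems(1) \<delta>0 \<theta>0 by (smt (verit) mult_pos_pos zero_less_power)
      have "\<theta> ^ p \<le> 1"
        using \<theta> \<theta>0 by (simp add: power_le_one)
      then have "r < \<delta>\<^sub>0"
        using small \<delta>0 by (smt (verit) mult_left_le)
      have "\<exists>m. ball_cover (r / \<delta> w) m F \<and> real m \<le> L * (r / \<delta> w) powr - t" if w: "w \<in> J" for w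
      proof (rule Suc.IH)
        have "\<delta>\<^sub>0 * \<theta> ^ p * \<delta> w \<le> \<delta>\<^sub>0 * \<theta> ^ p * \<theta>"
          using \<delta>(2)[OF w] \<delta>0 \<theta>0 by (intro mult_left_mono) auto
        also have "\<dots> \<le> r"
          using Suc.prems(1) by (simp add: mult_ac)
        finally show "\<delta>\<^sub>0 * \<theta> ^ p \<le> r / \<delta> w"
          using \<delta>(1)[OF w] by (simp add: pos_le_divide_eq)
        show "r / \<delta> w \<le> 1"
          using \<open>r < \<delta>\<^sub>0\<close> \<delta>0_le[OF w] \<delta>(1)[OF w] by simp
      qed
      then have "\<exists>k. \<forall>w\<in>J. ball_cover (r / \<delta> w) (k w) F \<and> real (k w) \<le> L * (r / \<delta> w) powr - t"
        by (intro bchoice) blast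
      then obtain k where k: "\<And>w. w \<in> J \<Longrightarrow> ball_cover (r / \<delta> w) (k w) F"
        "\<And>w. w \<in> J \<Longrightarrow> real (k w) \<le> L * (r / \<delta> w) powr - t"
        by blast
      obtain m where m: "ball_cover r m X" "real m \<le> K * r powr - t"
        using K(2)[OF r Suc.prems(2)] by blast
      have "ball_cover r ((\<Sum>w\<in>J. M w * k w) + m) F"
        using step[OF r k(1) m(1)] .
      moreover have "real ((\<Sum>w\<in>J. M w * k w) + m) \<le> L * r powr - t"
      proof -
        have "real ((\<Sum>w\<in>J. M w * k w) + m) = (\<Sum>w\<in>J. real (M w) * real (k w)) + real m"
          by simp
        also have "\<dots> \<le> (\<Sum>w\<in>J. real (M w) * (L * (r / \<delta> w) powr - t)) + K * r powr - t"
          using k(2) m(2) by (intro add_mono sum_mono mult_left_mono) auto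
        also have "(\<Sum>w\<in>J. real (M w) * (L * (r / \<delta> w) powr - t)) = q * L * r powr - t"
          unfolding q_def sum_distrib_right
        proof (rule sum.cong[OF refl])
          fix w assume "w \<in> J"
          then have "(r / \<delta> w) powr - t = \<delta> w powr t * r powr - t"
            using \<delta>(1) r by (simp add: powr_divide powr_minus divide_simps)
          then show "real (M w) * (L * (r / \<delta> w) powr - t) = real (M w) * \<delta> w powr t * L * r powr - t"
            by simp
        qed
        also have "q * L * r powr - t + K * r powr - t = (q * L + K) * r powr - t"
          by (simp add: distrib_right)
        also have "\<dots> \<le> L * r powr - t"
          using L(3) by (rule mult_right_mono) simp
        finally show ?thesis .
      qed
      ultimately show ?thesis by blast
    qed
  qed
  have "\<exists>m. ball_cover r m F \<and> real m \<le> L * r powr - t" if r: "0 < r" "r \<le> 1" for r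
  proof -
    have "(\<lambda>p. \<delta>\<^sub>0 * \<theta> ^ p) \<longlonglongrightarrow> 0"
      using \<theta> \<theta>0 by (intro tendsto_mult_right_zero LIMSEQ_power_zero) auto
    then have "\<forall>\<^sub>F p in sequentially. \<delta>\<^sub>0 * \<theta> ^ p < r"
      using r(1) by (rule order_tendstoD)
    then obtain p where "\<delta>\<^sub>0 * \<theta> ^ p < r"
      using eventually_happens'[OF sequentially_bot] by blast
    then show ?thesis
      using main[of p r] r(2) by simp
  qed
  then show ?thesis
    unfolding covering_growth_def using L(1) by blast
qed

section \<open>Inhomogeneous attractors\<close>

text \<open>Iterating the defining equation \<open>k\<close> times leaves images of \<open>F\<close> under words of length \<open>k\<close> and images of
  the condensation set under shorter words.\<close>

lemma attractor_word_decomposition: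
  assumes F: "F = (\<Union>i\<in>{1..N}. S i ` F) \<union> C"
  shows "F \<subseteq> (\<Union>w\<in>words N k. word_map S w ` F) \<union> (\<Union>w\<in>(\<Union>j<k. words N j). word_map S w ` C)"
proof (induction k)
  case 0
  show ?case by (auto simp: words_def)
next
  case (Suc k)
  show ?case
  proof
    fix x assume "x \<in> F"
    then consider "x \<in> C" | i y where "i \<in> {1..N}" "y \<in> F" "x = S i y"
      using F by blast
    then show "x \<in> (\<Union>w\<in>words N (Suc k). word_map S w ` F)
        \<union> (\<Union>w\<in>(\<Union>j<Suc k. words N j). word_map S w ` C)"
    proof cases
      case 1
      have "[] \<in> words N 0"
        by (simp add: words_def)
      then have "[] \<in> (\<Union>j<Suc k. words N j)"
        by blast
      with 1 show ?thesis
        by force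
    next
      case 2
      from 2(2) Suc.IH consider w z where "w \<in> words N k" "z \<in> F" "y = word_map S w z"
        | j w z where "j < k" "w \<in> words N j" "z \<in> C" "y = word_map S w z"
        by blast
      then show ?thesis
      proof cases
        case 1
        then have "i # w \<in> words N (Suc k)" "x = word_map S (i # w) z"
          using 2 by (auto simp: words_def)
        with 1 show ?thesis by blast
      next
        case (2 j)
        then have "i # w \<in> words N (Suc j)" "x = word_map S (i # w) z" "Suc j < Suc k"
          using \<open>i \<in> {1..N}\<close> \<open>x = S i y\<close> by (auto simp: words_def)
        with 2 show ?thesis by blast
      qed
    qed
  qed
qed

context contracting_affine_ifs
begin

text \<open>At a point of \<open>F\<^sub>0\<close> of greatest distance from \<open>F\<close>, the self-similarity of \<open>F\<^sub>0\<close> shows that this distance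
  is at most \<open>c\<close> times itself, hence zero.\<close>

lemma homogeneous_attractor_subset:
  assumes F0: "compact F\<^sub>0" "F\<^sub>0 = (\<Union>i\<in>{1..N}. S i ` F\<^sub>0)"
    and F: "compact F" "F \<noteq> {}" "(\<Union>i\<in>{1..N}. S i ` F) \<subseteq> F"
  shows "F\<^sub>0 \<subseteq> F"
proof (cases "F\<^sub>0 = {}")
  case False
  have "continuous_on F\<^sub>0 (\<lambda>x. infdist x F)"
    by (intro continuous_intros)
  then obtain x where x: "x \<in> F\<^sub>0" and max: "\<And>y. y \<in> F\<^sub>0 \<Longrightarrow> infdist y F \<le> infdist x F"
    using continuous_attains_sup[OF F0(1) False] by blast
  obtain i y where y: "i \<in> {1..N}" "y \<in> F\<^sub>0" "x = S i y"
    using x F0(2) by blast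
  obtain z where z: "z \<in> F" "infdist y F = dist y z"
    using infdist_attains_inf[of F y] F by (auto simp: compact_imp_closed)
  have "infdist x F \<le> dist (S i y) (S i z)"
    unfolding y(3) using F(3) y(1) z(1) by (intro infdist_le) blast
  also have "\<dots> \<le> c * infdist y F"
    using contracting[OF y(1), of y z] by (simp add: z(2) dist_norm)
  also have "\<dots> \<le> c * infdist x F"
    using max[OF y(2)] c by simp
  finally have "(1 - c) * infdist x F \<le> 0"
    by (simp add: algebra_simps)
  then have "infdist x F = 0"
    using c infdist_nonneg[of x F] by (smt (verit) mult_pos_pos)
  then have "infdist y F = 0" if "y \<in> F\<^sub>0" for y
    using max[OF that] infdist_nonneg[of y F] by simp
  then show ?thesis
    using in_closed_iff_infdist_zero[of F] F by (auto simp: compact_imp_closed)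
qed simp

text \<open>The renewal argument is applied to the IFS of all words of one length \<open>k\<close>, with the images of \<open>C\<close>
  under shorter words as condensation set. Words act as nonexpansive maps, so this set grows no faster
  than \<open>C\<close>.\<close>

lemma attractor_covering_growth:
  assumes F: "compact F" "F = (\<Union>i\<in>{1..N}. S i ` F) \<union> C"
    and t: "affinity_dimension N S < t" "t \<le> real CARD('n)" and C: "covering_growth t C"
  shows "covering_growth t F"
proof -
  let ?K = "(4 * real CARD('n)) ^ CARD('n)"
  have t0: "t \<ge> 0"
    using t(1) affinity_dimension_nonneg by simp
  obtain k where k: "k \<ge> 1" "?K * pressure_sum k t < 1"
    by (rule pressure_sum_small[OF t(1)])
  have "\<exists>\<delta> m. 0 < \<delta> \<and> \<delta> \<le> c ^ k \<and> ball_cover \<delta> m ((*v) (word_matrix w) ` cball 0 1)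
      \<and> real m * \<delta> powr t \<le> ?K * singular_value_function t (word_matrix w)"
    if "w \<in> words N k" for w
    by (rule ball_cover_singular_value_function[OF invertible_word_matrix[OF that] t0 t(2)
          norm_word_matrix_le[OF that]]) blast
  then obtain \<delta> M where \<delta>: "\<And>w. w \<in> words N k \<Longrightarrow> 0 < \<delta> w" "\<And>w. w \<in> words N k \<Longrightarrow> \<delta> w \<le> c ^ k"
    and M: "\<And>w. w \<in> words N k \<Longrightarrow> ball_cover (\<delta> w) (M w) ((*v) (word_matrix w) ` cball 0 1)"
      "\<And>w. w \<in> words N k \<Longrightarrow> real (M w) * \<delta> w powr t \<le> ?K * singular_value_function t (word_matrix w)"
    by metis
  define X where "X = (\<Union>w\<in>(\<Union>j<k. words N j). word_map S w ` C)"
  have decomp: "F \<subseteq> (\<Union>w\<in>words N k. word_map S w ` F) \<union> X"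
    unfolding X_def by (rule attractor_word_decomposition[OF F(2)])
  have X: "covering_growth t X"
    unfolding X_def
  proof (rule covering_growth_UN)
    fix w assume "w \<in> (\<Union>j<k. words N j)"
    then obtain j where j: "w \<in> words N j" by blast
    have "dist (word_map S w x) (word_map S w y) \<le> dist x y" for x y
    proof -
      have "c ^ j \<le> 1"
        using c by (simp add: power_le_one)
      then have "c ^ j * norm (x - y) \<le> norm (x - y)"
        by (simp add: mult_left_le_one_le c less_imp_le)
      then show ?thesis
        using word_map_contracting[OF j, of x y] by (simp add: dist_norm)
    qed
    with C show "covering_growth t (word_map S w ` C)"
      by (rule covering_growth_nonexpansive_image)
  qed auto
  show ?thesis
  proof (rule covering_growth_renewal[where J = "words N k" and \<theta> = "c ^ k"])
    show "c ^ k < 1"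
      using c k(1) by (intro power_less_one_iff[THEN iffD2]) auto
    have "(\<Sum>w\<in>words N k. real (M w) * \<delta> w powr t) \<le> ?K * pressure_sum k t"
      unfolding pressure_sum_def sum_distrib_left by (intro sum_mono M(2))
    then show "(\<Sum>w\<in>words N k. real (M w) * \<delta> w powr t) < 1"
      using k(2) by linarith
    show "\<exists>m. ball_cover r m F" if "r > 0" for r
      using ball_cover_bounded[OF compact_imp_bounded[OF F(1)] that] by metis
    show "ball_cover r ((\<Sum>w\<in>words N k. M w * l w) + m) F"
      if r: "0 < r" and l: "\<And>w. w \<in> words N k \<Longrightarrow> ball_cover (r / \<delta> w) (l w) F"
        and m: "ball_cover r m X" for r l m
    proof -
      have "ball_cover r (M w * l w) (word_map S w ` F)" if w: "w \<in> words N k" for w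
      proof -
        obtain b where b: "word_map S w = (\<lambda>x. word_matrix w *v x + b)"
          by (rule word_map_eq[of w]) (use w in \<open>simp add: words_def\<close>)
        have "ball_cover (\<delta> w * (r / \<delta> w)) (M w * l w) ((\<lambda>x. word_matrix w *v x + b) ` F)"
          using \<delta>(1)[OF w] r by (intro ball_cover_affine_image l[OF w] M(1)[OF w]) simp
        then show ?thesis
          using \<delta>(1)[OF w] by (simp add: b)
      qed
      then have "ball_cover r (\<Sum>w\<in>words N k. M w * l w) (\<Union>w\<in>words N k. word_map S w ` F)"
        by (intro ball_cover_UN) auto
      from ball_cover_mono[OF ball_cover_Un[OF this m] order_refl order_refl decomp] show ?thesis .
    qed
  qed (use words_nonempty \<delta> X t0 in auto)
qed

text \<open>Above dimension \<open>n\<close> the singular value function is no longer a covering quantity, but there the bound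
  is that of an arbitrary bounded set.\<close>

lemma attractor_upper_box_dim_le:
  assumes F: "compact F" "F = (\<Union>i\<in>{1..N}. S i ` F) \<union> C" and C: "compact C"
  shows "upper_box_dim F \<le> max (ereal (affinity_dimension N S)) (upper_box_dim C)"
proof (rule dense_ge)
  fix z assume z: "max (ereal (affinity_dimension N S)) (upper_box_dim C) < z"
  show "upper_box_dim F \<le> z"
  proof (cases z)
    case (real t)
    have s: "affinity_dimension N S < t" and dimC: "upper_box_dim C < ereal t"
      using z by (auto simp: real)
    have t0: "t \<ge> 0"
      using s affinity_dimension_nonneg by simp
    show ?thesis
    proof (cases "t \<le> real CARD('n)")
      case True
      have "covering_growth t C"
        using compact_imp_bounded[OF C] dimC by (rule covering_growth_upper_box_dim)
      then have "covering_growth t F"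
        by (rule attractor_covering_growth[OF F s True])
      then show ?thesis
        unfolding real by (rule upper_box_dim_le_covering_growth[OF _ t0])
    next
      case False
      have "upper_box_dim F \<le> ereal (real CARD('n))"
        by (intro upper_box_dim_le_covering_growth covering_growth_bounded compact_imp_bounded F) simp
      also have "\<dots> \<le> z"
        using False by (simp add: real)
      finally show ?thesis .
    qed
  qed (use z in auto)
qed

end

theorem corollary2p2:
  fixes N :: nat
    and S :: "nat \<Rightarrow> real ^ 'n \<Rightarrow> real ^ 'n"
    and C F\<^sub>0 F\<^sub>C :: "(real ^ 'n) set"
    and s :: real
  assumes "affine_ifs N S"
    and "s = affinity_dimension N S"
    and "C \<noteq> {}" and "compact C"
    and "is_inhomogeneous_attractor N S {} F\<^sub>0"
    and "is_inhomogeneous_attractor N S C F\<^sub>C"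
  shows "(upper_box_dim F\<^sub>0 = ereal s \<longrightarrow>
            upper_box_dim F\<^sub>C = max (upper_box_dim F\<^sub>0) (upper_box_dim C)) \<and>
         (upper_box_dim C \<ge> ereal s \<longrightarrow> upper_box_dim F\<^sub>C = upper_box_dim C)"
proof -
  obtain c where "contracting_affine_ifs N S c"
    by (rule contracting_affine_ifs_exists[OF assms(1)])
  then interpret contracting_affine_ifs N S c .
  have F0: "compact F\<^sub>0" "F\<^sub>0 = (\<Union>i\<in>{1..N}. S i ` F\<^sub>0)"
    using assms(5) by (simp_all add: is_inhomogeneous_attractor_def)
  have FC: "compact F\<^sub>C" "F\<^sub>C = (\<Union>i\<in>{1..N}. S i ` F\<^sub>C) \<union> C" "F\<^sub>C \<noteq> {}"
    using assms(6) by (auto simp: is_inhomogeneous_attractor_def)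
  have upper: "upper_box_dim F\<^sub>C \<le> max (ereal s) (upper_box_dim C)"
    unfolding assms(2) by (rule attractor_upper_box_dim_le[OF FC(1,2) assms(4)])
  have "F\<^sub>0 \<subseteq> F\<^sub>C"
    using FC by (intro homogeneous_attractor_subset[OF F0]) auto
  then have lower0: "upper_box_dim F\<^sub>0 \<le> upper_box_dim F\<^sub>C"
    by (rule upper_box_dim_mono[OF compact_imp_bounded[OF FC(1)]])
  have "C \<subseteq> F\<^sub>C"
    using FC(2) by blast
  then have lowerC: "upper_box_dim C \<le> upper_box_dim F\<^sub>C"
    by (rule upper_box_dim_mono[OF compact_imp_bounded[OF FC(1)]])
  show ?thesis
  proof (intro conjI impI)
    assume "upper_box_dim F\<^sub>0 = ereal s"
    with upper lower0 lowerC show "upper_box_dim F\<^sub>C = max (upper_box_dim F\<^sub>0) (upper_box_dim C)"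
      by (intro antisym) auto
  next
    assume "upper_box_dim C \<ge> ereal s"
    with upper lowerC show "upper_box_dim F\<^sub>C = upper_box_dim C"
      by (intro antisym) (auto simp: max_def split: if_splits)
  qed
qed

end
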